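(* Let $\mathbb{P}$ be a forcing notion. (i) If $\mathbb{P}$ adds random reals, then it adds mixing reals. (ii) If $\mathbb{P}$ adds dominating reals, then it adds mixing reals. (iii) If $\mathbb{P}$ adds Cohen reals, then it adds mixing injections. (iv) If $\mathbb{P}$ adds mixing injections, then it adds unbounded reals. (v) If $\mathbb{P}$ has the Laver property, then it does not add injective mixing reals.
   Context: $V$ is the ground model and $V^{\mathbb{P}}$ the generic extension. An $f\in\omega^\omega\cap V^{\mathbb{P}}$ is a mixing real over $V$ if $|f[X]\cap Y|=\omega$ for every $X,Y\in[\omega]^\omega\cap V$, where $[\omega]^\omega$ is the set of infinite subsets of $\omega$. If moreover $f$ is one-to-one, it is called an injective mixing real, or mixing injection. "$\mathbb{P}$ adds reals of a given kind" means that $V^{\mathbb{P}}$ contains such a real over $V$ (for every generic filter); "does not add" means that no generic extension by $\mathbb{P}$ contains one. A random (resp. Cohen) real over $V$ is a real avoiding every Borel null (resp. meager) set coded in $V$; a dominating real over $V$ is a $g\in\omega^\omega$ such that for every $f\in\omega^\omega\cap V$, $f(n)\le g(n)$ for all but finitely many $n$; an unbounded real over $V$ is a $g\in\omega^\omega$ such that for every $f\in\omega^\omega\cap V$, $g(n)>f(n)$ for infinitely many $n$. $\mathbb{P}$ has the Laver property if for every $f\in\omega^\omega\cap V^{\mathbb{P}}$ which is bounded pointwise by some $g\in\omega^\omega\cap V$ there is a function $S:\omega\to[\omega]^{<\omega}$ in $V$ with $|S(n)|\leq 2^n$ and $f(n)\in S(n)$ for all $n$. *)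

theory Defs
  imports "HOL-Probability.Probability"
begin

text \<open>
  The ground model \<open>V\<close> is the universe of HOL. Since no generic filter over it exists, statements
  about \<open>V\<^sup>P\<close> are expressed through the forcing relation.

  A forcing notion is a nonempty preorder, given as a relation \<open>P\<close> whose field is the set of
  conditions; \<open>(q, p) \<in> P\<close> means \<open>q \<le> p\<close>, i.e. \<open>q\<close> is the stronger condition.

  \<open>('a, 'p) name\<close> is the type of \<open>P\<close>-names for subsets of a ground-model set (the type \<open>'a\<close>): the
  set \<open>\<tau>\<close> stands for the \<open>P\<close>-name consisting of the pairs of a canonical name of \<open>a\<close> and \<open>p\<close>, for
  \<open>(a, p) \<in> \<tau>\<close>. Every subset of \<open>'a\<close> in a generic extension has a name of this form.

  A sentence of the forcing language is identified with the predicate \<open>\<lambda>p. p \<tturnstile> \<phi>\<close> on conditions;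
  the connectives below are the defining clauses of the forcing relation.
\<close>

type_synonym ('a, 'p) name = "('a \<times> 'p) set"
type_synonym 'p sentence = "'p \<Rightarrow> bool"

text \<open>
  Borel codes for subsets of the Cantor space \<open>2\<^sup>\<omega>\<close>. The function \<open>borel_set\<close> is the
  interpretation of a code in \<open>V\<close>; the interpretation in \<open>V\<^sup>P\<close> is \<open>in_borel_set\<close> below.
\<close>

datatype borel_code =
    Coordinate nat
  | Complement borel_code
  | CountableUnion "nat \<Rightarrow> borel_code"

primrec borel_set :: "borel_code \<Rightarrow> (nat \<Rightarrow> bool) set" where
  "borel_set (Coordinate n) = {x. x n}"
| "borel_set (Complement c) = - borel_set c"
| "borel_set (CountableUnion C) = (\<Union>k. borel_set (C k))"

definition cantor_measure :: "(nat \<Rightarrow> bool) measure" where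
  "cantor_measure = PiM UNIV (\<lambda>_. measure_pmf (bernoulli_pmf (1 / 2)))"

definition meager :: "'a::topological_space set \<Rightarrow> bool" where
  "meager A \<longleftrightarrow>
     (\<exists>N :: nat \<Rightarrow> 'a set. (\<forall>n. interior (closure (N n)) = {}) \<and> A \<subseteq> (\<Union>n. N n))"

instance bool :: second_countable_topology
proof
  show "\<exists>B :: bool set set. countable B \<and> open = generate_topology B"
    using open_bool_def by (intro exI[of _ "range (\<lambda>a. {..< a}) \<union> range (\<lambda>a. {a <..})"]) auto
qed

lemma sets_cantor_measure: "sets cantor_measure = sets borel"
proof -
  have "sets cantor_measure = sets (PiM UNIV (\<lambda>_::nat. borel :: bool measure))"
    unfolding cantor_measure_def
    by (intro sets_PiM_cong) (auto simp: sets_borel_eq_count_space)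
  then show ?thesis by (simp only: sets_PiM_equal_borel)
qed

lemma range_borel_set: "range borel_set = sets borel"
proof (intro equalityI subsetI)
  fix A assume "A \<in> range borel_set"
  then obtain c where c: "A = borel_set c" by auto
  have "borel_set c \<in> sets borel"
  proof (induction c)
    case (Coordinate n)
    have "open ((\<lambda>x::nat \<Rightarrow> bool. x n) -` {True})"
      by (rule open_vimage[OF Topological_Spaces.open_discrete continuous_on_product_coordinates])
    moreover have "(\<lambda>x::nat \<Rightarrow> bool. x n) -` {True} = {x. x n}" by auto
    ultimately show ?case by simp
  qed auto
  with c show "A \<in> sets borel" by simp
next
  fix A :: "(nat \<Rightarrow> bool) set" assume "A \<in> sets borel"
  then have "A \<in> sets (PiM UNIV (\<lambda>_::nat. borel :: bool measure))"
    by (simp add: sets_PiM_equal_borel)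
  then have "A \<in> sigma_sets UNIV {{f. f i \<in> B} |(i::nat) (B::bool set). True}"
    by (simp add: sets_PiM_single sets_borel_eq_count_space space_PiM)
  then show "A \<in> range borel_set"
  proof induction
    case (Basic A)
    then obtain i B where A: "A = {f. f i \<in> B}" by auto
    have univ: "borel_set (CountableUnion (\<lambda>k. if k = 0 then Coordinate i else Complement (Coordinate i))) = UNIV"
      by (auto split: if_splits) (metis less_not_refl zero_less_one)
    have "B = {} \<or> B = {True} \<or> B = {False} \<or> B = UNIV"
      using subset_UNIV[of B] unfolding UNIV_bool by blast
    then consider "A = - UNIV" | "A = {x. x i}" | "A = - {x. x i}" | "A = UNIV"
      unfolding A by auto
    then show ?case
    proof cases
      case 1
      then show ?thesis using univ by (metis borel_set.simps(2) rangeI)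
    next
      case 2
      then show ?thesis by (metis borel_set.simps(1) rangeI)
    next
      case 3
      then show ?thesis by (metis borel_set.simps(1,2) rangeI)
    next
      case 4
      then show ?thesis using univ by (metis rangeI)
    qed
  next
    case Empty
    have "{} = borel_set (Complement (CountableUnion (\<lambda>k. if k = 0 then Coordinate 0 else Complement (Coordinate 0))))"
      by (auto split: if_splits) (metis less_not_refl zero_less_one)
    then show ?case by (rule range_eqI)
  next
    case (Compl A)
    then obtain c where "A = borel_set c" by blast
    then have "UNIV - A = borel_set (Complement c)" by auto
    then show ?case by (rule range_eqI)
  next
    case (Union A)
    then obtain C where "\<And>k. A k = borel_set (C k)" by (metis imageE)
    then have "(\<Union>k. A k) = borel_set (CountableUnion C)" by simp
    then show ?case by blast
  qed
qed

locale forcing_notion =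
  fixes P :: "'p rel"
  assumes preorder: "preorder_on (Field P) P"
    and nonempty: "P \<noteq> {}"
begin

text \<open>\<open>ground b\<close> is a statement about ground-model objects only.\<close>

definition ground :: "bool \<Rightarrow> 'p sentence" where
  "ground b = (\<lambda>p. b)"

definition elem :: "'a \<Rightarrow> ('a, 'p) name \<Rightarrow> 'p sentence" where
  "elem a \<tau> = (\<lambda>p. \<forall>q. (q, p) \<in> P \<longrightarrow> (\<exists>r s. (r, q) \<in> P \<and> (a, s) \<in> \<tau> \<and> (r, s) \<in> P))"

definition fneg :: "'p sentence \<Rightarrow> 'p sentence" (\<open>\<^bold>\<not> _\<close> [40] 40) where
  "(\<^bold>\<not> \<phi>) = (\<lambda>p. \<forall>q. (q, p) \<in> P \<longrightarrow> \<not> \<phi> q)"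

definition fconj :: "'p sentence \<Rightarrow> 'p sentence \<Rightarrow> 'p sentence" (infixr \<open>\<^bold>\<and>\<close> 35) where
  "(\<phi> \<^bold>\<and> \<psi>) = (\<lambda>p. \<phi> p \<and> \<psi> p)"

definition fimp :: "'p sentence \<Rightarrow> 'p sentence \<Rightarrow> 'p sentence" (infixr \<open>\<^bold>\<longrightarrow>\<close> 25) where
  "(\<phi> \<^bold>\<longrightarrow> \<psi>) = (\<lambda>p. \<forall>q. (q, p) \<in> P \<longrightarrow> \<phi> q \<longrightarrow> \<psi> q)"

text \<open>
  The quantifiers range either over ground-model objects (a ground-model set or class such as
  \<open>\<omega>\<close>, \<open>\<omega>\<^sup>\<omega> \<inter> V\<close> or the Borel codes in \<open>V\<close>), or, when the bound variable is a name, over the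
  subsets of a ground-model set that lie in \<open>V\<^sup>P\<close>.
\<close>

definition fall :: "('x \<Rightarrow> 'p sentence) \<Rightarrow> 'p sentence" (binder \<open>\<^bold>\<forall>\<close> 10) where
  "(\<^bold>\<forall>x. \<phi> x) = (\<lambda>p. \<forall>x. \<phi> x p)"

definition fex :: "('x \<Rightarrow> 'p sentence) \<Rightarrow> 'p sentence" (binder \<open>\<^bold>\<exists>\<close> 10) where
  "(\<^bold>\<exists>x. \<phi> x) = (\<lambda>p. \<forall>q. (q, p) \<in> P \<longrightarrow> (\<exists>r x. (r, q) \<in> P \<and> \<phi> x r))"

definition inf_many :: "(nat \<Rightarrow> 'p sentence) \<Rightarrow> 'p sentence" (binder \<open>\<^bold>\<exists>\<^sub>\<infinity>\<close> 10) where
  "(\<^bold>\<exists>\<^sub>\<infinity>n. \<phi> n) = (\<^bold>\<forall>k. \<^bold>\<exists>n. ground (k \<le> n) \<^bold>\<and> \<phi> n)"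

definition almost_all :: "(nat \<Rightarrow> 'p sentence) \<Rightarrow> 'p sentence" (binder \<open>\<^bold>\<forall>\<^sub>\<infinity>\<close> 10) where
  "(\<^bold>\<forall>\<^sub>\<infinity>n. \<phi> n) = (\<^bold>\<exists>k. \<^bold>\<forall>n. ground (k \<le> n) \<^bold>\<longrightarrow> \<phi> n)"

definition forced :: "'p sentence \<Rightarrow> bool" where
  "forced \<phi> \<longleftrightarrow> (\<forall>p\<in>Field P. \<phi> p)"

text \<open>
  Elements of \<open>\<omega>\<^sup>\<omega> \<inter> V\<^sup>P\<close> are named by their graphs, elements of \<open>2\<^sup>\<omega> \<inter> V\<^sup>P\<close> by the subsets of
  \<open>\<omega>\<close> of which they are the characteristic functions.
\<close>

definition is_function :: "(nat \<times> nat, 'p) name \<Rightarrow> 'p sentence" where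
  "is_function f =
     ((\<^bold>\<forall>n. \<^bold>\<exists>i. elem (n, i) f) \<^bold>\<and>
      (\<^bold>\<forall>n i j. elem (n, i) f \<^bold>\<and> elem (n, j) f \<^bold>\<longrightarrow> ground (i = j)))"

definition is_injective :: "(nat \<times> nat, 'p) name \<Rightarrow> 'p sentence" where
  "is_injective f =
     (\<^bold>\<forall>m n i. elem (m, i) f \<^bold>\<and> elem (n, i) f \<^bold>\<longrightarrow> ground (m = n))"

text \<open>\<open>value_sat f n R\<close>: the value \<open>f(n)\<close> belongs to the ground-model set \<open>{i. R i}\<close>.\<close>

definition value_sat :: "(nat \<times> nat, 'p) name \<Rightarrow> nat \<Rightarrow> (nat \<Rightarrow> bool) \<Rightarrow> 'p sentence" where
  "value_sat f n R = (\<^bold>\<exists>i. elem (n, i) f \<^bold>\<and> ground (R i))"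

definition is_mixing :: "(nat \<times> nat, 'p) name \<Rightarrow> 'p sentence" where
  "is_mixing f =
     (\<^bold>\<forall>(X :: nat set) (Y :: nat set). ground (infinite X \<and> infinite Y) \<^bold>\<longrightarrow>
        (\<^bold>\<exists>\<^sub>\<infinity>i. ground (i \<in> Y) \<^bold>\<and> (\<^bold>\<exists>n. ground (n \<in> X) \<^bold>\<and> elem (n, i) f)))"

definition is_dominating :: "(nat \<times> nat, 'p) name \<Rightarrow> 'p sentence" where
  "is_dominating g = (\<^bold>\<forall>f :: nat \<Rightarrow> nat. \<^bold>\<forall>\<^sub>\<infinity>n. value_sat g n (\<lambda>i. f n \<le> i))"

definition is_unbounded :: "(nat \<times> nat, 'p) name \<Rightarrow> 'p sentence" where
  "is_unbounded g = (\<^bold>\<forall>f :: nat \<Rightarrow> nat. \<^bold>\<exists>\<^sub>\<infinity>n. value_sat g n (\<lambda>i. i > f n))"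

primrec in_borel_set :: "(nat, 'p) name \<Rightarrow> borel_code \<Rightarrow> 'p sentence" where
  "in_borel_set x (Coordinate n) = elem n x"
| "in_borel_set x (Complement c) = (\<^bold>\<not> in_borel_set x c)"
| "in_borel_set x (CountableUnion C) = (\<^bold>\<exists>k. in_borel_set x (C k))"

definition is_random :: "(nat, 'p) name \<Rightarrow> 'p sentence" where
  "is_random x =
     (\<^bold>\<forall>c. ground (borel_set c \<in> null_sets cantor_measure) \<^bold>\<longrightarrow> \<^bold>\<not> in_borel_set x c)"

definition is_cohen :: "(nat, 'p) name \<Rightarrow> 'p sentence" where
  "is_cohen x = (\<^bold>\<forall>c. ground (meager (borel_set c)) \<^bold>\<longrightarrow> \<^bold>\<not> in_borel_set x c)"

definition adds_random_reals :: bool where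
  "adds_random_reals \<longleftrightarrow> forced (\<^bold>\<exists>x. is_random x)"

definition adds_cohen_reals :: bool where
  "adds_cohen_reals \<longleftrightarrow> forced (\<^bold>\<exists>x. is_cohen x)"

definition adds_dominating_reals :: bool where
  "adds_dominating_reals \<longleftrightarrow> forced (\<^bold>\<exists>g. is_function g \<^bold>\<and> is_dominating g)"

definition adds_unbounded_reals :: bool where
  "adds_unbounded_reals \<longleftrightarrow> forced (\<^bold>\<exists>g. is_function g \<^bold>\<and> is_unbounded g)"

definition adds_mixing_reals :: bool where
  "adds_mixing_reals \<longleftrightarrow> forced (\<^bold>\<exists>f. is_function f \<^bold>\<and> is_mixing f)"

definition adds_mixing_injections :: bool where
  "adds_mixing_injections \<longleftrightarrow>
     forced (\<^bold>\<exists>f. is_function f \<^bold>\<and> is_injective f \<^bold>\<and> is_mixing f)"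

text \<open>Stronger than \<open>\<not> adds_mixing_injections\<close>: no generic extension contains one.\<close>

definition adds_no_mixing_injections :: bool where
  "adds_no_mixing_injections \<longleftrightarrow>
     forced (\<^bold>\<not> (\<^bold>\<exists>f. is_function f \<^bold>\<and> is_injective f \<^bold>\<and> is_mixing f))"

definition laver_property :: bool where
  "laver_property \<longleftrightarrow>
     forced (\<^bold>\<forall>f. is_function f \<^bold>\<longrightarrow>
       (\<^bold>\<exists>g :: nat \<Rightarrow> nat. \<^bold>\<forall>n. value_sat f n (\<lambda>i. i \<le> g n)) \<^bold>\<longrightarrow>
       (\<^bold>\<exists>S :: nat \<Rightarrow> nat set.
          ground (\<forall>n. finite (S n) \<and> card (S n) \<le> 2 ^ n) \<^bold>\<and>
          (\<^bold>\<forall>n. value_sat f n (\<lambda>i. i \<in> S n))))"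

end

end

theory Submission
  imports Defs
begin

text \<open>
  Random and Cohen reals. For \<open>z \<in> 2\<^sup>\<omega>\<close> split into columns let \<open>G(n)\<close> be the first zero of
  column \<open>n\<close>. For random \<open>z\<close> the \<open>G(n)\<close> are independent and take each value \<open>i\<close> with probability
  \<open>2\<^sup>-\<^sup>(\<^sup>i\<^sup>+\<^sup>1\<^sup>)\<close>, so \<open>G\<close> takes each value on each infinite ground-model set. For Cohen \<open>z\<close>, the
  function \<open>G\<close> is made injective by replacing values already taken; the conditions deciding
  \<open>f(n) \<in> Y\<close> for some \<open>n \<in> X\<close> remain dense.

  Dominating reals. If \<open>g\<close> is dominating and the intervals \<open>[b\<^sub>i, b\<^sub>i\<^sub>+\<^sub>1)\<close> are obtained by iterating
  \<open>g\<close>, then every infinite ground-model set meets almost all of them, so the function with value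
  \<open>i\<close> on the \<open>i\<close>-th interval is mixing.

  Unbounded reals. If \<open>f\<close> is a mixing injection, then \<open>g(n) = max (f(n)) (f\<^sup>-\<^sup>1(n))\<close> is unbounded:
  given \<open>h\<close>, take \<open>s\<^sub>0 < s\<^sub>1 < \<dots>\<close> with \<open>s\<^sub>j\<^sub>+\<^sub>1 > h(s\<^sub>j)\<close>; some \<open>f(s\<^sub>2\<^sub>a) = s\<^sub>2\<^sub>b\<^sub>+\<^sub>1\<close>, and \<open>g > h\<close> at
  the smaller of the two points.

  Laver property. The finite traces of an injection \<open>f\<close> on \<open>4\<^sup>k\<^sup>+\<^sup>1 \<times> 4\<^sup>k\<^sup>+\<^sup>1\<close> are captured by sets \<open>S(k)\<close>
  of at most \<open>2\<^sup>k\<close> partial injections. Counting gives \<open>x\<^sub>k, y\<^sub>k\<close> in \<open>[4\<^sup>k, 4\<^sup>k\<^sup>+\<^sup>1)\<close> such that no member of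
  \<open>S(k)\<close> maps \<open>x\<^sub>i\<close> to \<open>y\<^sub>j\<close> for \<open>max i j = k\<close>; hence \<open>f\<close> maps no \<open>x\<^sub>i\<close> to a \<open>y\<^sub>j\<close>.
\<close>

section \<open>The forcing relation\<close>

context forcing_notion
begin

lemma le_refl: "p \<in> Field P \<Longrightarrow> (p, p) \<in> P"
  using preorder by (auto simp: preorder_on_def refl_on_def)

lemma le_trans: "(r, q) \<in> P \<Longrightarrow> (q, p) \<in> P \<Longrightarrow> (r, p) \<in> P"
  using preorder by (auto simp: preorder_on_def dest: transD)

lemma le_Field: "(q, p) \<in> P \<Longrightarrow> q \<in> Field P" "(q, p) \<in> P \<Longrightarrow> p \<in> Field P"
  by (auto simp: Field_def)

lemma elem_mono: "elem a \<tau> p \<Longrightarrow> (q, p) \<in> P \<Longrightarrow> elem a \<tau> q"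
  unfolding elem_def using le_trans by blast

lemma elem_dense:
  assumes "\<And>q. (q, p) \<in> P \<Longrightarrow> \<exists>r. (r, q) \<in> P \<and> elem a \<tau> r"
  shows "elem a \<tau> p"
  unfolding elem_def by (meson assms elem_def le_refl le_Field le_trans)

text \<open>Names below are comprehensions \<open>{(a, q). \<psi> a q}\<close>. Introduction needs
  \<open>\<psi>\<close> at all stronger conditions. Elimination yields \<open>\<psi>\<close> only at
  some \<open>s\<close> above an extension \<open>r\<close>, so \<open>\<psi>\<close> should persist
  downwards.\<close>

lemma elem_nameI:
  assumes "p \<in> Field P" "\<And>q. (q, p) \<in> P \<Longrightarrow> \<psi> a q"
  shows "elem a {(a, q). q \<in> Field P \<and> \<psi> a q} p"
  unfolding elem_def using assms le_refl le_Field by (metis (mono_tags, lifting) case_prodI mem_Collect_eq)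

lemma elem_nameD:
  assumes "elem a {(a, q). q \<in> Field P \<and> \<psi> a q} p" "(q, p) \<in> P"
  obtains r s where "(r, q) \<in> P" "(r, s) \<in> P" "\<psi> a s"
  using assms unfolding elem_def by blast

lemma is_function_iff:
  "is_function f p \<longleftrightarrow>
     (\<forall>n q. (q, p) \<in> P \<longrightarrow> (\<exists>r i. (r, q) \<in> P \<and> elem (n, i) f r)) \<and>
     (\<forall>n i j q. (q, p) \<in> P \<longrightarrow> elem (n, i) f q \<longrightarrow> elem (n, j) f q \<longrightarrow> i = j)"
  by (auto simp: is_function_def fconj_def fall_def fex_def fimp_def ground_def)

lemma is_function_mono: "is_function f p \<Longrightarrow> (q, p) \<in> P \<Longrightarrow> is_function f q"
  unfolding is_function_iff using le_trans by meson

lemma is_injective_iff: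
  "is_injective f p \<longleftrightarrow>
     (\<forall>m n i q. (q, p) \<in> P \<longrightarrow> elem (m, i) f q \<longrightarrow> elem (n, i) f q \<longrightarrow> m = n)"
  by (auto simp: is_injective_def fconj_def fall_def fimp_def ground_def)

lemma is_injective_mono: "is_injective f p \<Longrightarrow> (q, p) \<in> P \<Longrightarrow> is_injective f q"
  unfolding is_injective_iff using le_trans by meson

lemma value_sat_iff:
  "value_sat f n R p \<longleftrightarrow> (\<forall>q. (q, p) \<in> P \<longrightarrow> (\<exists>r i. (r, q) \<in> P \<and> elem (n, i) f r \<and> R i))"
  by (simp add: value_sat_def fconj_def fex_def ground_def)

lemma inf_many_iff:
  "(\<^bold>\<exists>\<^sub>\<infinity>n. \<phi> n) p \<longleftrightarrow> (\<forall>k q. (q, p) \<in> P \<longrightarrow> (\<exists>r n. (r, q) \<in> P \<and> k \<le> n \<and> \<phi> n r))"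
  by (simp add: inf_many_def fall_def fex_def fconj_def ground_def)

text \<open>The two nested existential quantifiers cost two successive strengthenings, which
  transitivity merges into one; conversely the witness \<open>n\<close> persists because
  \<open>elem\<close> is monotone.\<close>

lemma is_mixing_iff:
  "is_mixing f p \<longleftrightarrow>
     (\<forall>X Y k q. infinite X \<longrightarrow> infinite Y \<longrightarrow> (q, p) \<in> P \<longrightarrow>
        (\<exists>r i n. (r, q) \<in> P \<and> k \<le> i \<and> i \<in> Y \<and> n \<in> X \<and> elem (n, i) f r))"
  (is "?L \<longleftrightarrow> ?R")
proof
  assume L: ?L
  show ?R
  proof (intro allI impI)
    fix X Y :: "nat set" and k q
    assume XY: "infinite X" "infinite Y" and q: "(q, p) \<in> P"
    then have "(q, q) \<in> P" using le_refl le_Field by blast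
    with XY q obtain r i where r: "(r, q) \<in> P" "k \<le> i" "i \<in> Y"
      and *: "\<And>q. (q, r) \<in> P \<Longrightarrow> \<exists>r n. (r, q) \<in> P \<and> n \<in> X \<and> elem (n, i) f r"
      using L unfolding is_mixing_def fall_def fimp_def inf_many_iff fconj_def ground_def fex_def
      by metis
    obtain s n where s: "(s, r) \<in> P" "n \<in> X" "elem (n, i) f s"
      using *[OF le_refl] r(1) le_Field by blast
    with r show "\<exists>r i n. (r, q) \<in> P \<and> k \<le> i \<and> i \<in> Y \<and> n \<in> X \<and> elem (n, i) f r"
      using le_trans[OF s(1) r(1)] by blast
  qed
next
  assume R: ?R
  show ?L
    unfolding is_mixing_def fall_def fimp_def inf_many_iff fconj_def ground_def fex_def
  proof (intro allI impI)
    fix X Y :: "nat set" and q k q'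
    assume "(q, p) \<in> P" "infinite X \<and> infinite Y" "(q', q) \<in> P"
    with R le_trans[of q' q p] obtain r i n
      where r: "(r, q') \<in> P" "k \<le> i" "i \<in> Y" "n \<in> X" "elem (n, i) f r"
      by blast
    show "\<exists>r n. (r, q') \<in> P \<and> k \<le> n \<and> n \<in> Y \<and>
            (\<forall>q. (q, r) \<in> P \<longrightarrow> (\<exists>ra x. (ra, q) \<in> P \<and> x \<in> X \<and> elem (x, n) f ra))"
      using r elem_mono[OF r(5)] le_refl[OF le_Field(1)] by blast
  qed
qed

lemma fexD: "(\<^bold>\<exists>x. \<phi> x) p \<Longrightarrow> p \<in> Field P \<Longrightarrow> \<exists>q x. (q, p) \<in> P \<and> \<phi> x q"
  unfolding fex_def using le_refl by blast

text \<open>Forced existence asks for witnesses only at densely many conditions, so names can be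
  transformed below one condition at a time without gluing them together.\<close>

lemma forced_fexI:
  assumes "forced (\<^bold>\<exists>x. \<phi> x)" "\<And>p x. p \<in> Field P \<Longrightarrow> \<phi> x p \<Longrightarrow> \<exists>y. \<psi> y p"
  shows "forced (\<^bold>\<exists>y. \<psi> y)"
  using assms unfolding forced_def fex_def by (meson le_Field)

lemma forced_no_fexI:
  assumes "\<And>p x. p \<in> Field P \<Longrightarrow> \<not> \<phi> x p"
  shows "forced (\<^bold>\<not> (\<^bold>\<exists>x. \<phi> x))"
  using assms unfolding forced_def fneg_def fex_def by (meson le_refl le_Field)

text \<open>
  The function \<open>\<gamma>\<close> is the value of \<open>f\<close> along a descending sequence of conditions. It behaves as the
  value in a generic extension for the countably many statements \<open>f(n) = i\<close>.
\<close>

lemma generic_function: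
  assumes f: "is_function f p" and p: "p \<in> Field P"
  obtains \<gamma> where "\<And>n. \<exists>r. (r, p) \<in> P \<and> (\<forall>m<n. elem (m, \<gamma> m) f r)"
proof -
  have "\<exists>r. \<forall>n. (r n, p) \<in> P \<and> ((r (Suc n), r n) \<in> P \<and> (\<exists>i. elem (n, i) f (r (Suc n))))"
  proof (rule dependent_nat_choice)
    show "\<exists>r. (r, p) \<in> P" using p le_refl by blast
    show "\<exists>s. (s, p) \<in> P \<and> (s, r) \<in> P \<and> (\<exists>i. elem (n, i) f s)" if "(r, p) \<in> P" for r n
      using f that unfolding is_function_iff by (meson le_trans)
  qed
  then obtain r where r: "\<And>n. (r n, p) \<in> P" "\<And>n. (r (Suc n), r n) \<in> P"
    and "\<And>n. \<exists>i. elem (n, i) f (r (Suc n))"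
    by blast
  then obtain \<gamma> where \<gamma>: "\<And>n. elem (n, \<gamma> n) f (r (Suc n))" by metis
  have "elem (m, \<gamma> m) f (r n)" if "m < n" for m n
    using that
  proof (induction n)
    case (Suc n)
    then show ?case using \<gamma>[of n] elem_mono[OF _ r(2)] by (auto simp: less_Suc_eq)
  qed simp
  with r(1) that show thesis by blast
qed

lemma generic_function_unique:
  assumes f: "is_function f p" and \<gamma>: "\<And>n. \<exists>r. (r, p) \<in> P \<and> (\<forall>m<n. elem (m, \<gamma> m) f r)"
    and i: "elem (n, i) f p"
  shows "\<gamma> n = i"
proof -
  obtain r where r: "(r, p) \<in> P" "elem (n, \<gamma> n) f r" using \<gamma>[of "Suc n"] by blast
  with f elem_mono[OF i r(1)] show ?thesis unfolding is_function_iff by blast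
qed

text \<open>No single condition need force all of \<open>\<gamma>\<close>, but a statement about one
  value concerns only an initial segment, which some condition below \<open>p\<close>
  forces.\<close>

lemma generic_function_value_sat:
  assumes f: "is_function f p" and \<gamma>: "\<And>n. \<exists>r. (r, p) \<in> P \<and> (\<forall>m<n. elem (m, \<gamma> m) f r)"
    and R: "value_sat f n R p"
  shows "R (\<gamma> n)"
proof -
  obtain r where r: "(r, p) \<in> P" "elem (n, \<gamma> n) f r" using \<gamma>[of "Suc n"] by blast
  with R obtain s i where "(s, r) \<in> P" "elem (n, i) f s" "R i"
    unfolding value_sat_iff by blast
  with f r have "\<gamma> n = i" unfolding is_function_iff using elem_mono le_trans by meson
  with \<open>R i\<close> show ?thesis by simp
qed

text \<open>A collision involves two arguments only, so a condition forcing a long enough initial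
  segment of \<open>\<gamma>\<close> would force it for \<open>f\<close>.\<close>

lemma generic_function_inj:
  assumes f: "is_injective f p" and \<gamma>: "\<And>n. \<exists>r. (r, p) \<in> P \<and> (\<forall>m<n. elem (m, \<gamma> m) f r)"
  shows "inj \<gamma>"
proof (rule injI)
  fix m n assume eq: "\<gamma> m = \<gamma> n"
  obtain r where r: "(r, p) \<in> P" "elem (m, \<gamma> m) f r" "elem (n, \<gamma> n) f r"
    using \<gamma>[of "Suc (max m n)"] by (auto simp: less_Suc_eq_le)
  with f eq show "m = n" unfolding is_injective_iff by metis
qed

text \<open>
  A name for \<open>\<Phi> f\<close>, for a ground-model operator \<open>\<Phi>\<close> such that \<open>\<Phi> \<gamma> k\<close> depends only on the
  restriction of \<open>\<gamma>\<close> to \<open>{..<L k}\<close>.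
\<close>

definition operator_name ::
  "(nat \<Rightarrow> nat) \<Rightarrow> ((nat \<Rightarrow> nat) \<Rightarrow> nat \<Rightarrow> nat) \<Rightarrow> (nat \<times> nat, 'p) name \<Rightarrow> (nat \<times> nat, 'p) name"
  where "operator_name L \<Phi> f =
    {(a, q). q \<in> Field P \<and> (\<exists>\<gamma>. \<Phi> \<gamma> (fst a) = snd a \<and> (\<forall>m<L (fst a). elem (m, \<gamma> m) f q))}"

lemma elem_operator_nameI:
  assumes "q \<in> Field P" "\<And>m. m < L k \<Longrightarrow> elem (m, \<gamma> m) f q"
  shows "elem (k, \<Phi> \<gamma> k) (operator_name L \<Phi> f) q"
  unfolding operator_name_def
proof (rule elem_nameI[OF assms(1)])
  fix r assume r: "(r, q) \<in> P"
  have "\<forall>m<L k. elem (m, \<gamma> m) f r" using elem_mono[OF assms(2) r] by blast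
  then show "\<exists>\<delta>. \<Phi> \<delta> (fst (k, \<Phi> \<gamma> k)) = snd (k, \<Phi> \<gamma> k) \<and> (\<forall>m<L (fst (k, \<Phi> \<gamma> k)). elem (m, \<delta> m) f r)"
    by auto
qed

text \<open>Values exist because a run \<open>\<gamma>\<close> is forced up to \<open>L k\<close> by
  some condition. They are unique because two witnesses must agree below \<open>L k\<close> at a
  common extension, and then \<open>local\<close> applies.\<close>

lemma is_function_operator_name:
  assumes f: "is_function f p"
    and local: "\<And>\<gamma> \<delta> k. (\<And>m. m < L k \<Longrightarrow> \<gamma> m = \<delta> m) \<Longrightarrow> \<Phi> \<gamma> k = \<Phi> \<delta> k"
  shows "is_function (operator_name L \<Phi> f) p"
  unfolding is_function_iff
proof (intro conjI allI impI)
  fix k q assume "(q, p) \<in> P"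
  with f obtain \<gamma> where "\<And>n. \<exists>r. (r, q) \<in> P \<and> (\<forall>m<n. elem (m, \<gamma> m) f r)"
    using is_function_mono generic_function le_Field by metis
  then obtain r where "(r, q) \<in> P" "\<forall>m<L k. elem (m, \<gamma> m) f r" by blast
  then show "\<exists>r i. (r, q) \<in> P \<and> elem (k, i) (operator_name L \<Phi> f) r"
    using elem_operator_nameI[of r L k \<gamma> f \<Phi>] le_Field by blast
next
  fix k v w q
  assume q: "(q, p) \<in> P" and v: "elem (k, v) (operator_name L \<Phi> f) q"
    and w: "elem (k, w) (operator_name L \<Phi> f) q"
  have *: "\<exists>r \<gamma>. (r, q') \<in> P \<and> \<Phi> \<gamma> k = v \<and> (\<forall>m<L k. elem (m, \<gamma> m) f r)"
    if "elem (k, v) (operator_name L \<Phi> f) q'" "q' \<in> Field P" for v q'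
    using elem_nameD[OF that(1)[unfolded operator_name_def] le_refl[OF that(2)]] elem_mono
    by (metis fst_conv snd_conv)
  obtain r \<gamma> where r: "(r, q) \<in> P" "\<Phi> \<gamma> k = v" "\<forall>m<L k. elem (m, \<gamma> m) f r"
    using *[OF v] q le_Field by metis
  obtain s \<delta> where s: "(s, r) \<in> P" "\<Phi> \<delta> k = w" "\<forall>m<L k. elem (m, \<delta> m) f s"
    using *[OF elem_mono[OF w r(1)]] r le_Field by metis
  have "\<gamma> m = \<delta> m" if "m < L k" for m
    using f that r s q elem_mono le_trans unfolding is_function_iff by meson
  then show "v = w" using local[of k \<gamma> \<delta>] r s by simp
qed

end

section \<open>Dominating reals\<close>

text \<open>The interval from \<open>b\<close> is \<open>[b, b + g b]\<close>. It contains
  \<open>g b\<close> when \<open>b <= g b\<close>, and the successor keeps the starts strictly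
  increasing even where \<open>g\<close> vanishes.\<close>

primrec interval_start :: "(nat \<Rightarrow> nat) \<Rightarrow> nat \<Rightarrow> nat" where
  "interval_start g 0 = 0"
| "interval_start g (Suc i) = Suc (interval_start g i + g (interval_start g i))"

definition interval_index :: "(nat \<Rightarrow> nat) \<Rightarrow> nat \<Rightarrow> nat" where
  "interval_index g n = (LEAST i. n < interval_start g (Suc i))"

lemma strict_mono_interval_start: "strict_mono (interval_start g)"
  by (simp add: strict_mono_Suc_iff)

lemma le_interval_start: "i \<le> interval_start g i"
  using strict_mono_imp_increasing[OF strict_mono_interval_start] .

lemma interval_index_eqI:
  assumes "interval_start g i \<le> n" "n < interval_start g (Suc i)"
  shows "interval_index g n = i"
  unfolding interval_index_def
proof (rule Least_equality)
  show "n < interval_start g (Suc i)" by fact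
next
  fix j assume "n < interval_start g (Suc j)"
  with assms(1) have "interval_start g i < interval_start g (Suc j)" by linarith
  then show "i \<le> j" using strict_mono_interval_start by (metis less_Suc_eq_le strict_mono_less)
qed

lemma interval_index:
  "interval_start g (interval_index g n) \<le> n" "n < interval_start g (Suc (interval_index g n))"
proof -
  have ex: "n < interval_start g (Suc n)" using le_interval_start[of "Suc n" g] by simp
  then show "n < interval_start g (Suc (interval_index g n))"
    unfolding interval_index_def by (rule LeastI)
  show "interval_start g (interval_index g n) \<le> n"
  proof (cases "interval_index g n")
    case (Suc i)
    then have "\<not> n < interval_start g (Suc i)"
      unfolding interval_index_def using not_less_Least by (metis lessI)
    with Suc show ?thesis by simp
  qed simp
qed

text \<open>Locating \<open>n\<close> consults \<open>g\<close> only at interval starts that do not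
  exceed \<open>n\<close>; this justifies the modulus \<open>Suc\<close> in
  \<open>operator_name\<close>.\<close>

lemma interval_index_local:
  assumes "\<And>m. m < Suc n \<Longrightarrow> g m = h m"
  shows "interval_index g n = interval_index h n"
proof -
  have eq: "interval_start h i = interval_start g i" if "interval_start g i \<le> n" for i
    using that
  proof (induction i)
    case (Suc i)
    then have "interval_start g i \<le> n" by simp
    with Suc.IH have "interval_start h i = interval_start g i" by blast
    with assms[of "interval_start g i"] \<open>interval_start g i \<le> n\<close> show ?case by simp
  qed simp
  define i where "i = interval_index g n"
  have i: "interval_start g i \<le> n" "n < interval_start g (Suc i)"
    using interval_index i_def by auto
  with eq[OF i(1)] assms[of "interval_start g i"] have "interval_index h n = i"
    by (intro interval_index_eqI) auto
  with i_def show ?thesis by simp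
qed

context forcing_notion
begin

lemma dominating_imp_mixing:
  assumes p: "p \<in> Field P" and g: "is_function g p" "is_dominating g p"
  shows "is_mixing (operator_name Suc interval_index g) p"
  unfolding is_mixing_iff
proof (intro allI impI)
  fix X Y :: "nat set" and k q
  assume X: "infinite X" and Y: "infinite Y" and q: "(q, p) \<in> P"
  \<comment> \<open>The next element of \<open>X\<close> is a ground-model function, hence
    eventually dominated by \<open>g\<close>.\<close>
  define h where "h n = (LEAST x. n \<le> x \<and> x \<in> X)" for n
  have h: "n \<le> h n" "h n \<in> X" for n
    using LeastI_ex[of "\<lambda>x. n \<le> x \<and> x \<in> X"] X
    unfolding h_def infinite_nat_iff_unbounded_le by blast+
  from g(2) q obtain r K where r: "(r, q) \<in> P"
    and dom: "\<And>n q. K \<le> n \<Longrightarrow> (q, r) \<in> P \<Longrightarrow> value_sat g n (\<lambda>i. h n \<le> i) q"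
    unfolding is_dominating_def fall_def almost_all_def fex_def fimp_def ground_def by blast
  have g': "is_function g r" and rF: "r \<in> Field P"
    using g(1) le_trans[OF r q] is_function_mono le_Field by blast+
  obtain \<gamma> where \<gamma>: "\<And>n. \<exists>s. (s, r) \<in> P \<and> (\<forall>m<n. elem (m, \<gamma> m) g s)"
    using generic_function[OF g' rF] by blast
  have dom\<gamma>: "h n \<le> \<gamma> n" if "K \<le> n" for n
    using generic_function_value_sat[OF g' \<gamma> dom[OF that le_refl[OF rF]]] .
  \<comment> \<open>The bound \<open>k\<close> serves the mixing requirement; the bound
    \<open>K\<close> makes the \<open>i\<close>-th interval start where domination already
    holds.\<close>
  obtain i where i: "max k K \<le> i" "i \<in> Y" using Y unfolding infinite_nat_iff_unbounded_le by blast
  define b where "b = interval_start \<gamma> i"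
  have "K \<le> b" using i(1) le_interval_start[of i \<gamma>] unfolding b_def by linarith
  \<comment> \<open>From \<open>b \<le> h b \<le> \<gamma> b\<close> the point \<open>h b\<close> of
    \<open>X\<close> falls into the \<open>i\<close>-th interval.\<close>
  from dom\<gamma>[OF this] h(1)[of b] have "interval_index \<gamma> (h b) = i"
    by (intro interval_index_eqI) (simp_all add: b_def)
  moreover obtain s where s: "(s, r) \<in> P" "\<forall>m<Suc (h b). elem (m, \<gamma> m) g s"
    using \<gamma>[of "Suc (h b)"] by blast
  ultimately have "elem (h b, i) (operator_name Suc interval_index g) s"
    using elem_operator_nameI[of s Suc "h b" \<gamma> g interval_index] le_Field(1)[OF s(1)] by simp
  with i h(2)[of b] le_trans[OF s(1) r]
  show "\<exists>r i n. (r, q) \<in> P \<and> k \<le> i \<and> i \<in> Y \<and> n \<in> X \<and>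
          elem (n, i) (operator_name Suc interval_index g) r"
    by (meson max.boundedE)
qed

lemma adds_dominating_imp_adds_mixing: "adds_dominating_reals \<Longrightarrow> adds_mixing_reals"
  unfolding adds_dominating_reals_def adds_mixing_reals_def
  by (erule forced_fexI)
    (auto simp: fconj_def
      intro!: exI[of _ "operator_name Suc interval_index _"] is_function_operator_name
        interval_index_local dominating_imp_mixing)

end

section \<open>Unbounded reals\<close>

context forcing_notion
begin

text \<open>
  \<open>g(n) = max (f(n)) (f\<^sup>-\<^sup>1(n))\<close>, where \<open>g(n) = f(n)\<close> if \<open>n\<close> is not a value of \<open>f\<close>.
\<close>

definition max_inverse_name :: "(nat \<times> nat, 'p) name \<Rightarrow> (nat \<times> nat, 'p) name" where
  "max_inverse_name f = {(a, q). q \<in> Field P \<and> (\<exists>i. elem (fst a, i) f q \<and>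
     ((\<exists>m. elem (m, fst a) f q \<and> snd a = max i m) \<or>
      ((\<forall>m r. (r, q) \<in> P \<longrightarrow> \<not> elem (m, fst a) f r) \<and> snd a = i)))}"

lemma elem_max_inverse_nameI:
  assumes q: "q \<in> Field P" and i: "elem (n, i) f q"
    and v: "(\<exists>m. elem (m, n) f q \<and> v = max i m) \<or>
      (\<forall>m r. (r, q) \<in> P \<longrightarrow> \<not> elem (m, n) f r) \<and> v = i"
  shows "elem (n, v) (max_inverse_name f) q"
  unfolding max_inverse_name_def
proof (rule elem_nameI[OF q])
  fix r assume r: "(r, q) \<in> P"
  have mono: "elem (m, n) f r" if "elem (m, n) f q" for m using elem_mono[OF that r] .
  have "(\<exists>m. elem (m, n) f r \<and> v = max i m) \<or>
      (\<forall>m s. (s, r) \<in> P \<longrightarrow> \<not> elem (m, n) f s) \<and> v = i"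
    using v mono le_trans[OF _ r] by blast
  with elem_mono[OF i r] show "\<exists>i. elem (fst (n, v), i) f r \<and>
     ((\<exists>m. elem (m, fst (n, v)) f r \<and> snd (n, v) = max i m) \<or>
      ((\<forall>m s. (s, r) \<in> P \<longrightarrow> \<not> elem (m, fst (n, v)) f s) \<and> snd (n, v) = i))"
    by auto
qed

text \<open>If \<open>f(n) = m\<close>, then \<open>g\<close> is large at both points. At
  \<open>n\<close> a strengthening first decides whether \<open>n\<close> has a preimage; at
  \<open>m\<close> the preimage \<open>n\<close> is known and only \<open>f(m)\<close> must be
  decided.\<close>

lemma max_inverse_name_ge:
  assumes f: "is_function f p" and q: "(q, p) \<in> P"
    and mn: "elem (n, m) f q"
  shows "\<exists>r v. (r, q) \<in> P \<and> elem (n, v) (max_inverse_name f) r \<and> m \<le> v"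
    and "\<exists>r v. (r, q) \<in> P \<and> elem (m, v) (max_inverse_name f) r \<and> n \<le> v"
proof -
  show "\<exists>r v. (r, q) \<in> P \<and> elem (n, v) (max_inverse_name f) r \<and> m \<le> v"
  proof (cases "\<exists>l s. (s, q) \<in> P \<and> elem (l, n) f s")
    case True
    then obtain l s where s: "(s, q) \<in> P" "elem (l, n) f s" by blast
    then have "elem (n, max m l) (max_inverse_name f) s"
      using elem_mono[OF mn s(1)] le_Field by (intro elem_max_inverse_nameI) auto
    then show ?thesis using s(1) max.cobounded1 by blast
  next
    case False
    then have "elem (n, m) (max_inverse_name f) q"
      using q mn le_Field by (intro elem_max_inverse_nameI) auto
    then show ?thesis using q le_refl le_Field by blast
  qed
  obtain r j where r: "(r, q) \<in> P" "elem (m, j) f r" using f q unfolding is_function_iff by blast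
  then have "elem (m, max j n) (max_inverse_name f) r"
    using elem_mono[OF mn r(1)] le_Field by (intro elem_max_inverse_nameI) auto
  then show "\<exists>r v. (r, q) \<in> P \<and> elem (m, v) (max_inverse_name f) r \<and> n \<le> v"
    using r(1) max.cobounded2 by blast
qed

text \<open>Injectivity of \<open>f\<close> makes the preimage entering the maximum unique. The two
  alternatives of the definition cannot clash, since the negative one speaks about all stronger
  conditions.\<close>

lemma is_function_max_inverse_name:
  assumes f: "is_function f p" "is_injective f p"
  shows "is_function (max_inverse_name f) p"
  unfolding is_function_iff
proof (intro conjI allI impI)
  fix n q assume q: "(q, p) \<in> P"
  with f obtain r i where r: "(r, q) \<in> P" "elem (n, i) f r" unfolding is_function_iff by blast
  then show "\<exists>r v. (r, q) \<in> P \<and> elem (n, v) (max_inverse_name f) r"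
    using max_inverse_name_ge(1)[OF f(1) le_trans[OF r(1) q] r(2)] le_trans[OF _ r(1)] by blast
next
  fix n v w q
  assume q: "(q, p) \<in> P" and v: "elem (n, v) (max_inverse_name f) q"
    and w: "elem (n, w) (max_inverse_name f) q"
  have *: "\<exists>r i. (r, q') \<in> P \<and> elem (n, i) f r \<and> ((\<exists>m. elem (m, n) f r \<and> v = max i m) \<or>
      (\<forall>m s. (s, r) \<in> P \<longrightarrow> \<not> elem (m, n) f s) \<and> v = i)"
    if v: "elem (n, v) (max_inverse_name f) q'" and q': "q' \<in> Field P" for v q'
  proof -
    obtain r s i where r: "(r, q') \<in> P" "(r, s) \<in> P" and i: "elem (n, i) f s"
      and m: "(\<exists>m. elem (m, n) f s \<and> v = max i m) \<or>
      (\<forall>m t. (t, s) \<in> P \<longrightarrow> \<not> elem (m, n) f t) \<and> v = i"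
      using elem_nameD[OF v[unfolded max_inverse_name_def] le_refl[OF q']] by (metis fst_conv snd_conv)
    have mono: "elem (m, n) f r" if "elem (m, n) f s" for m using elem_mono[OF that r(2)] .
    have "(\<exists>m. elem (m, n) f r \<and> v = max i m) \<or>
      (\<forall>m t. (t, r) \<in> P \<longrightarrow> \<not> elem (m, n) f t) \<and> v = i"
      using m mono le_trans[OF _ r(2)] by blast
    with r(1) elem_mono[OF i r(2)] show ?thesis by blast
  qed
  obtain r i where r: "(r, q) \<in> P" "elem (n, i) f r"
    "(\<exists>m. elem (m, n) f r \<and> v = max i m) \<or> (\<forall>m s. (s, r) \<in> P \<longrightarrow> \<not> elem (m, n) f s) \<and> v = i"
    using *[OF v] q le_Field by metis
  obtain s j where s: "(s, r) \<in> P" "elem (n, j) f s"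
    "(\<exists>m. elem (m, n) f s \<and> w = max j m) \<or> (\<forall>m t. (t, s) \<in> P \<longrightarrow> \<not> elem (m, n) f t) \<and> w = j"
    using *[OF elem_mono[OF w r(1)]] r le_Field by metis
  have sp: "(s, p) \<in> P" using le_trans[OF s(1) le_trans[OF r(1) q]] .
  have sF: "(s, s) \<in> P" using le_refl le_Field s(1) by blast
  have "i = j" using f(1) sp elem_mono[OF r(2) s(1)] s(2) unfolding is_function_iff by blast
  moreover have "m = m'" if "elem (m, n) f r" "elem (m', n) f s" for m m'
    using f(2) sp elem_mono[OF that(1) s(1)] that(2) unfolding is_injective_iff by blast
  ultimately show "v = w" using r(3) s(3) sF s(1) by (metis elem_mono)
qed

lemma value_sat_mono: "value_sat f n R p \<Longrightarrow> (q, p) \<in> P \<Longrightarrow> value_sat f n R q"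
  unfolding value_sat_iff using le_trans by meson

lemma value_satI: "elem (n, i) f p \<Longrightarrow> R i \<Longrightarrow> value_sat f n R p"
  unfolding value_sat_iff using elem_mono le_refl le_Field by meson

lemma is_unbounded_max_inverse_name:
  assumes f: "is_function f p" "is_mixing f p"
  shows "is_unbounded (max_inverse_name f) p"
  unfolding is_unbounded_def fall_def inf_many_iff
proof (intro allI impI)
  fix h :: "nat \<Rightarrow> nat" and k q assume q: "(q, p) \<in> P"
  \<comment> \<open>Starting at \<open>k\<close> places every witness at or beyond
    \<open>k\<close>.\<close>
  define s where "s = rec_nat k (\<lambda>_ n. Suc (n + h n))"
  have s_Suc: "s (Suc j) = Suc (s j + h (s j))" and s_0: "s 0 = k" for j by (simp_all add: s_def)
  have mono: "strict_mono s" by (simp add: strict_mono_Suc_iff s_Suc)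
  have large: "h (s i) < s j" if "i < j" for i j
  proof -
    have "s (Suc i) \<le> s j" using that mono by (simp add: strict_mono_less_eq Suc_leI)
    then show ?thesis using s_Suc[of i] by linarith
  qed
  have ge: "k \<le> s j" for j using mono s_0 by (metis le0 strict_mono_less_eq)
  \<comment> \<open>Even and odd indices keep the two sets disjoint, so the argument and the value
    found by mixing have different indices.\<close>
  have inf: "infinite (range (\<lambda>j. s (2 * j)))" "infinite (range (\<lambda>j. s (Suc (2 * j))))"
    using mono by (intro range_inj_infinite injI; simp add: strict_mono_eq)+
  obtain r i n where r: "(r, q) \<in> P"
    and "i \<in> range (\<lambda>j. s (Suc (2 * j)))" "n \<in> range (\<lambda>j. s (2 * j))" and ni: "elem (n, i) f r"
    using f(2)[unfolded is_mixing_iff, rule_format, OF inf q] by blast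
  then obtain a b where ab: "n = s a" "i = s b" "a \<noteq> b" using double_not_eq_Suc_double by blast
  note rp = le_trans[OF r q]
  have "\<exists>t m v. (t, r) \<in> P \<and> k \<le> m \<and> elem (m, v) (max_inverse_name f) t \<and> h m < v"
  proof (cases "a < b")
    case True
    with max_inverse_name_ge(1)[OF f(1) rp ni] ge[of a] large[of a b] ab show ?thesis
      by (meson less_le_trans)
  next
    case False
    with max_inverse_name_ge(2)[OF f(1) rp ni] ge[of b] large[of b a] ab show ?thesis
      by (meson less_le_trans linorder_neqE_nat)
  qed
  then obtain t m v where "(t, r) \<in> P" "k \<le> m" "elem (m, v) (max_inverse_name f) t" "h m < v"
    by blast
  then show "\<exists>r n. (r, q) \<in> P \<and> k \<le> n \<and> value_sat (max_inverse_name f) n (\<lambda>i. h n < i) r"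
    using value_satI[where R = "\<lambda>i. h m < i"] le_trans[OF _ r] by blast
qed

lemma adds_mixing_injections_imp_adds_unbounded:
  "adds_mixing_injections \<Longrightarrow> adds_unbounded_reals"
  unfolding adds_mixing_injections_def adds_unbounded_reals_def
  by (erule forced_fexI)
    (auto simp: fconj_def
      intro!: exI[of _ "max_inverse_name _"] is_function_max_inverse_name is_unbounded_max_inverse_name)

end

section \<open>The Laver property\<close>

text \<open>The block has \<open>3 * 4 ^ k\<close> points, while the at most
  \<open>2 ^ k * Suc k\<close> sets \<open>B R j\<close>, each with at most one point, cover at most
  \<open>4 ^ k\<close>.\<close>

lemma block_not_covered:
  fixes S :: "'s set"
  assumes "finite S" "card S \<le> 2 ^ k" "\<And>R j. R \<in> S \<Longrightarrow> \<exists>z. B R j \<subseteq> {z}"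
  shows "\<exists>x\<in>{4 ^ k..<4 ^ Suc k :: nat}. \<forall>R\<in>S. \<forall>j\<le>k. x \<notin> B R j"
proof (rule ccontr)
  assume "\<not> ?thesis"
  then have cover: "\<exists>R\<in>S. \<exists>j\<le>k. x \<in> B R j" if "x \<in> {4 ^ k..<4 ^ Suc k}" for x using that by blast
  have "{4 ^ k..<4 ^ Suc k} \<subseteq> (\<Union>Rj\<in>S \<times> {..k}. B (fst Rj) (snd Rj))"
  proof
    fix x :: nat assume "x \<in> {4 ^ k..<4 ^ Suc k}"
    with cover obtain R j where "R \<in> S" "j \<le> k" "x \<in> B R j" by blast
    then show "x \<in> (\<Union>Rj\<in>S \<times> {..k}. B (fst Rj) (snd Rj))" by (intro UN_I[of "(R, j)"]) auto
  qed
  moreover have fin: "finite (B (fst Rj) (snd Rj)) \<and> card (B (fst Rj) (snd Rj)) \<le> 1"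
    if Rj: "Rj \<in> S \<times> {..k}" for Rj
  proof -
    obtain z where "B (fst Rj) (snd Rj) \<subseteq> {z}" using assms(3)[of "fst Rj" "snd Rj"] Rj by (auto simp: mem_Times_iff)
    then show ?thesis using finite_subset[of _ "{z}"] card_mono[of "{z}"] by simp
  qed
  ultimately have "card {4 ^ k..<4 ^ Suc k :: nat} \<le> card (\<Union>Rj\<in>S \<times> {..k}. B (fst Rj) (snd Rj))"
    using assms(1) by (intro card_mono) auto
  also have "\<dots> \<le> (\<Sum>Rj\<in>S \<times> {..k}. card (B (fst Rj) (snd Rj)))"
    using assms(1) by (intro card_UN_le) auto
  also have "\<dots> \<le> card (S \<times> {..k})" using fin sum_mono[of "S \<times> {..k}" "\<lambda>Rj. card (B (fst Rj) (snd Rj))" "\<lambda>_. 1"] by simp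
  also have "\<dots> \<le> 2 ^ k * Suc k"
    unfolding card_cartesian_product card_atMost using assms(2) by (rule mult_right_mono) simp
  also have "\<dots> \<le> 2 ^ k * 2 ^ k" by (intro mult_left_mono) (simp_all add: Suc_leI)
  also have "\<dots> = 4 ^ k" by (simp add: power_mult_distrib[symmetric])
  finally show False by simp
qed

lemma single_valued_subset_singleton: "single_valued R \<Longrightarrow> \<exists>z. {y. (x, y) \<in> R} \<subseteq> {z}"
  by (intro exI[of _ "THE y. (x, y) \<in> R"])
    (auto simp: single_valued_def intro!: the_equality[symmetric])

lemma infinite_range_power_le:
  fixes h :: "nat \<Rightarrow> nat"
  assumes "\<And>k. 4 ^ k \<le> h k"
  shows "infinite (range h)"
  unfolding infinite_nat_iff_unbounded
proof
  fix m
  have "m < 4 ^ m" by (rule power_gt_expt) simp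
  with assms[of m] show "\<exists>n>m. n \<in> range h" by (intro exI[of _ "h m"]) auto
qed

text \<open>Points \<open>x\<close> and \<open>y\<close> are chosen block by block, and stage
  \<open>k\<close> settles all pairs whose larger index is \<open>k\<close>. Each member of
  \<open>S k\<close> forbids at most one new \<open>x\<close> per earlier \<open>y\<close>, and at
  most one new \<open>y\<close> per earlier or current \<open>x\<close>.\<close>

lemma small_slaloms_avoid_rectangle:
  fixes S :: "nat \<Rightarrow> (nat \<times> nat) set set"
  assumes S: "\<And>k. finite (S k)" "\<And>k. card (S k) \<le> 2 ^ k"
    and inj: "\<And>k R. R \<in> S k \<Longrightarrow> single_valued R" "\<And>k R. R \<in> S k \<Longrightarrow> single_valued (R\<inverse>)"
  obtains X Y where "infinite X" "infinite Y"
    "\<And>x y. x \<in> X \<Longrightarrow> y \<in> Y \<Longrightarrow>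
       \<exists>k. x < 4 ^ Suc k \<and> y < 4 ^ Suc k \<and> (\<forall>R\<in>S k. (x, y) \<notin> R)"
proof -
  define Q where "Q = (\<lambda>(f :: nat \<Rightarrow> nat \<times> nat) k (x, y).
    x \<in> {4 ^ k..<4 ^ Suc k :: nat} \<and> y \<in> {4 ^ k..<4 ^ Suc k :: nat} \<and>
    (\<forall>R\<in>S k. (x, y) \<notin> R \<and> (\<forall>j<k. (x, snd (f j)) \<notin> R \<and> (fst (f j), y) \<notin> R)))"
  have "\<exists>f. \<forall>k. Q f k (f k)"
  proof (rule dependent_wellorder_choice)
    show "Q f k r = Q g k r" if "\<And>j. j < k \<Longrightarrow> f j = g j" for r f g k
      using that by (auto simp: Q_def split: prod.splits)
    show "\<exists>r. Q f k r" for k f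
    proof -
      \<comment> \<open>The index \<open>j = k\<close> refers to a pair not yet chosen; only
        \<open>j < k\<close> is kept.\<close>
      have "\<exists>x\<in>{4 ^ k..<4 ^ Suc k :: nat}. \<forall>R\<in>S k. \<forall>j\<le>k. x \<notin> {x. (x, snd (f j)) \<in> R}"
        using single_valued_subset_singleton[OF inj(2)] by (intro block_not_covered S) simp
      then obtain x where x: "x \<in> {4 ^ k..<4 ^ Suc k :: nat}"
        and x': "\<And>R j. R \<in> S k \<Longrightarrow> j < k \<Longrightarrow> (x, snd (f j)) \<notin> R"
        by (auto simp: less_imp_le)
      have "\<exists>y\<in>{4 ^ k..<4 ^ Suc k :: nat}. \<forall>R\<in>S k. \<forall>j\<le>k.
              y \<notin> {y. (if j < k then fst (f j) else x, y) \<in> R}"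
        \<comment> \<open>Here the index \<open>j = k\<close> stands for the new \<open>x\<close>,
          which handles the diagonal pair as well.\<close>
        using single_valued_subset_singleton[OF inj(1)] by (intro block_not_covered S) simp
      then obtain y where y: "y \<in> {4 ^ k..<4 ^ Suc k :: nat}"
        and y': "\<And>R j. R \<in> S k \<Longrightarrow> j \<le> k \<Longrightarrow> (if j < k then fst (f j) else x, y) \<notin> R"
        by auto
      have "(x, y) \<notin> R" if "R \<in> S k" for R using y'[OF that, of k] by simp
      moreover have "(fst (f j), y) \<notin> R" if "R \<in> S k" "j < k" for R j
        using y'[OF that(1), of j] that(2) by simp
      ultimately have "Q f k (x, y)" using x x' y unfolding Q_def by blast
      then show ?thesis ..
    qed
  qed
  then obtain f where f: "\<And>k. Q f k (f k)" by blast
  have bounds: "4 ^ k \<le> fst (f k)" "fst (f k) < 4 ^ Suc k" "4 ^ k \<le> snd (f k)" "snd (f k) < 4 ^ Suc k"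
    and avoid: "\<And>R. R \<in> S k \<Longrightarrow> (fst (f k), snd (f k)) \<notin> R"
      "\<And>R j. R \<in> S k \<Longrightarrow> j < k \<Longrightarrow> (fst (f k), snd (f j)) \<notin> R"
      "\<And>R j. R \<in> S k \<Longrightarrow> j < k \<Longrightarrow> (fst (f j), snd (f k)) \<notin> R" for k
    using f[of k] unfolding Q_def by (auto simp: split_beta)
  have mono: "4 ^ Suc j \<le> (4 ^ Suc k :: nat)" if "j \<le> k" for j k :: nat
    using that by (intro power_increasing) auto
  show thesis
  proof (rule that)
    show "infinite (range (\<lambda>k. fst (f k)))" "infinite (range (\<lambda>k. snd (f k)))"
      using bounds by (intro infinite_range_power_le; simp)+
    fix x y assume "x \<in> range (\<lambda>k. fst (f k))" "y \<in> range (\<lambda>k. snd (f k))"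
    then obtain j k where xy: "x = fst (f j)" "y = snd (f k)" by blast
    have "x < 4 ^ Suc (max j k)" "y < 4 ^ Suc (max j k)"
      using bounds(2)[of j] mono[of j "max j k"] bounds(4)[of k] mono[of k "max j k"]
      unfolding xy by linarith+
    moreover have "(x, y) \<notin> R" if "R \<in> S (max j k)" for R
      using that avoid unfolding xy by (cases j k rule: linorder_cases) auto
    ultimately show "\<exists>k. x < 4 ^ Suc k \<and> y < 4 ^ Suc k \<and> (\<forall>R\<in>S k. (x, y) \<notin> R)" by blast
  qed
qed

section \<open>Finite traces coded as natural numbers\<close>

definition trace_code :: "(nat \<Rightarrow> nat) \<Rightarrow> nat \<Rightarrow> nat" where
  "trace_code g k =
     set_encode (prod_encode ` {(m, i). m < 4 ^ Suc k \<and> i < 4 ^ Suc k \<and> g m = i})"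

lemma finite_trace: "finite {(m, i). m < N \<and> i < (N :: nat) \<and> g m = i}"
  by (rule finite_subset[of _ "{..<N} \<times> {..<N}"]) auto

text \<open>Cutting off values as well as arguments leaves finitely many possible traces, so the
  bound is independent of \<open>g\<close>, as the Laver property requires.\<close>

lemma trace_code_bound:
  obtains b :: "nat \<Rightarrow> nat" where "\<And>g k. trace_code g k \<le> b k"
proof
  fix g :: "nat \<Rightarrow> nat" and k
  have "{(m, i). m < 4 ^ Suc k \<and> i < 4 ^ Suc k \<and> g m = i} \<in> Pow ({..<4 ^ Suc k} \<times> {..<4 ^ Suc k})"
    by auto
  then show "trace_code g k \<le>
      Max ((\<lambda>R. set_encode (prod_encode ` R)) ` Pow ({..<4 ^ Suc k} \<times> {..<4 ^ Suc k}))"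
    unfolding trace_code_def by (intro Max_ge imageI) auto
qed

context forcing_notion
begin

lemma laver_imp_no_mixing_injection:
  assumes laver: laver_property and p: "p \<in> Field P"
    and f: "is_function f p" "is_injective f p"
  shows "\<not> is_mixing f p"
proof
  assume mixing: "is_mixing f p"
  define h where "h = operator_name (\<lambda>k. 4 ^ Suc k) trace_code f"
  have local: "trace_code \<gamma> k = trace_code \<delta> k" if "\<And>m. m < 4 ^ Suc k \<Longrightarrow> \<gamma> m = \<delta> m" for \<gamma> \<delta> k
  proof -
    have "{(m, i). m < 4 ^ Suc k \<and> i < 4 ^ Suc k \<and> \<gamma> m = i} =
      {(m, i). m < 4 ^ Suc k \<and> i < 4 ^ Suc k \<and> \<delta> m = i}"
      using that by auto
    then show ?thesis by (simp add: trace_code_def)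
  qed
  have h_fun: "is_function h p" unfolding h_def by (rule is_function_operator_name[OF f(1) local])
  have h_val: "\<exists>r \<gamma>. (r, q) \<in> P \<and> elem (k, trace_code \<gamma> k) h r"
    if q: "(q, p) \<in> P" for q k
  proof -
    obtain \<gamma> where "\<And>n. \<exists>s. (s, q) \<in> P \<and> (\<forall>m<n. elem (m, \<gamma> m) f s)"
      using generic_function[OF is_function_mono[OF f(1) q] le_Field(1)[OF q]] by blast
    then obtain r where "(r, q) \<in> P" "\<forall>m<4 ^ Suc k. elem (m, \<gamma> m) f r" by blast
    then show ?thesis
      unfolding h_def using elem_operator_nameI[of r "\<lambda>k. 4 ^ Suc k" k \<gamma> f trace_code] le_Field(1)
      by blast
  qed
  obtain b where b: "\<And>g k. trace_code g k \<le> b k" using trace_code_bound by blast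
  have bound: "value_sat h k (\<lambda>i. i \<le> b k) p" for k
    unfolding value_sat_iff using h_val[of _ k] b by blast
  have ex: "(\<^bold>\<exists>g :: nat \<Rightarrow> nat. \<^bold>\<forall>n. value_sat h n (\<lambda>i. i \<le> g n)) p"
    unfolding fex_def fall_def
  proof (intro allI impI exI conjI)
    fix q n assume q: "(q, p) \<in> P"
    show "(q, q) \<in> P" using le_refl[OF le_Field(1)[OF q]] .
    show "value_sat h n (\<lambda>i. i \<le> b n) q" using value_sat_mono[OF bound q] .
  qed
  have pp: "(p, p) \<in> P" using le_refl[OF p] .
  have "(is_function h \<^bold>\<longrightarrow> (\<^bold>\<exists>g :: nat \<Rightarrow> nat. \<^bold>\<forall>n. value_sat h n (\<lambda>i. i \<le> g n)) \<^bold>\<longrightarrow>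
      (\<^bold>\<exists>S :: nat \<Rightarrow> nat set. ground (\<forall>n. finite (S n) \<and> card (S n) \<le> 2 ^ n) \<^bold>\<and>
        (\<^bold>\<forall>n. value_sat h n (\<lambda>i. i \<in> S n)))) p"
    using bspec[OF laver[unfolded laver_property_def forced_def] p] unfolding fall_def by (rule spec)
  then have "(\<^bold>\<exists>S :: nat \<Rightarrow> nat set. ground (\<forall>n. finite (S n) \<and> card (S n) \<le> 2 ^ n) \<^bold>\<and>
        (\<^bold>\<forall>n. value_sat h n (\<lambda>i. i \<in> S n))) p"
    unfolding fimp_def using h_fun ex pp by metis
  from fexD[OF this p] obtain q S where q: "(q, p) \<in> P"
    and "(ground (\<forall>n. finite (S n) \<and> card (S n) \<le> 2 ^ n) \<^bold>\<and>
      (\<^bold>\<forall>n. value_sat h n (\<lambda>i. i \<in> S n))) q"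
    by blast
  then have S: "\<And>n. finite (S n)" "\<And>n. card (S n) \<le> 2 ^ n"
    and val: "\<And>n. value_sat h n (\<lambda>i. i \<in> S n) q"
    unfolding fall_def fconj_def ground_def by simp_all
  \<comment> \<open>Guesses that do not decode to partial injections are discarded; the true trace
    survives because \<open>f\<close> is forced to be injective.\<close>
  define T where "T k = {R \<in> (\<lambda>c. prod_decode ` set_decode c) ` S k.
    single_valued R \<and> single_valued (R\<inverse>)}" for k
  have T: "finite (T k)" "card (T k) \<le> 2 ^ k" for k
  proof -
    have sub: "T k \<subseteq> (\<lambda>c. prod_decode ` set_decode c) ` S k" unfolding T_def by blast
    show "finite (T k)" using finite_surj[OF S(1) sub] .
    have "card (T k) \<le> card (S k)" using surj_card_le[OF S(1) sub] .
    also note S(2)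
    finally show "card (T k) \<le> 2 ^ k" .
  qed
  obtain X Y where XY: "infinite X" "infinite Y"
    and avoid: "\<And>x y. x \<in> X \<Longrightarrow> y \<in> Y \<Longrightarrow>
       \<exists>k. x < 4 ^ Suc k \<and> y < 4 ^ Suc k \<and> (\<forall>R\<in>T k. (x, y) \<notin> R)"
    using small_slaloms_avoid_rectangle[of T] T unfolding T_def by blast
  obtain r x y where r: "(r, q) \<in> P" and "x \<in> X" "y \<in> Y" and xy: "elem (x, y) f r"
    using mixing XY q unfolding is_mixing_iff by blast
  with avoid obtain k where k: "x < 4 ^ Suc k" "y < 4 ^ Suc k" "\<And>R. R \<in> T k \<Longrightarrow> (x, y) \<notin> R" by blast
  have rp: "(r, p) \<in> P" using le_trans[OF r q] .
  note f' = is_function_mono[OF f(1) rp] is_injective_mono[OF f(2) rp]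
  \<comment> \<open>Running below \<open>r\<close> makes \<open>\<gamma>\<close> injective with
    \<open>\<gamma> x = y\<close>.\<close>
  obtain \<gamma> where \<gamma>: "\<And>n. \<exists>s. (s, r) \<in> P \<and> (\<forall>m<n. elem (m, \<gamma> m) f s)"
    using generic_function[OF f'(1) le_Field(1)[OF r]] by blast
  note \<gamma>_inj = generic_function_inj[OF f'(2) \<gamma>] and \<gamma>_xy = generic_function_unique[OF f'(1) \<gamma> xy]
  obtain s where s: "(s, r) \<in> P" "\<forall>m<4 ^ Suc k. elem (m, \<gamma> m) f s" using \<gamma> by blast
  have hs: "elem (k, trace_code \<gamma> k) h s"
    unfolding h_def using elem_operator_nameI[of s "\<lambda>k. 4 ^ Suc k" k \<gamma> f trace_code] s le_Field(1)
    by blast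
  \<comment> \<open>At \<open>t\<close> both \<open>c\<close> and the code of the trace of
    \<open>\<gamma>\<close> are values of \<open>h\<close> at \<open>k\<close>, hence equal; so the
    trace containing \<open>(x, y)\<close> was among the guesses.\<close>
  obtain t c where t: "(t, s) \<in> P" "elem (k, c) h t" "c \<in> S k"
    using val[of k] le_trans[OF s(1) r] unfolding value_sat_iff by blast
  have "(t, p) \<in> P" using le_trans[OF t(1) le_trans[OF s(1) rp]] .
  then have c: "c = trace_code \<gamma> k"
    using h_fun t(2) elem_mono[OF hs t(1)] unfolding is_function_iff by blast
  define R where "R = {(m, i). m < 4 ^ Suc k \<and> i < 4 ^ Suc k \<and> \<gamma> m = i}"
  have "prod_decode ` set_decode c = R"
    unfolding c trace_code_def R_def using finite_trace[of "4 ^ Suc k" \<gamma>]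
    by (simp add: set_encode_inverse image_image)
  moreover have "single_valued R" "single_valued (R\<inverse>)"
    using \<gamma>_inj by (auto simp: R_def single_valued_def dest: injD)
  ultimately have "R \<in> T k" using t(3) unfolding T_def by blast
  with k \<gamma>_xy show False unfolding R_def by blast
qed

lemma laver_imp_adds_no_mixing_injections: "laver_property \<Longrightarrow> adds_no_mixing_injections"
  unfolding adds_no_mixing_injections_def
  using laver_imp_no_mixing_injection by (intro forced_no_fexI) (auto simp: fconj_def)

end

section \<open>Interpreting Borel codes at a real avoiding an ideal\<close>

context forcing_notion
begin

lemma in_borel_set_mono: "in_borel_set x c p \<Longrightarrow> (q, p) \<in> P \<Longrightarrow> in_borel_set x c q"
proof (induction c)
  case (Coordinate n)
  then show ?case using elem_mono by simp
next
  case (Complement c)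
  then show ?case using le_trans[OF _ Complement.prems(2)] by (auto simp: fneg_def)
next
  case (CountableUnion C)
  then show ?case using le_trans[OF _ CountableUnion.prems(2)] by (auto simp: fex_def)
qed

lemma in_borel_set_dense:
  assumes "\<And>q. (q, p) \<in> P \<Longrightarrow> \<exists>r. (r, q) \<in> P \<and> in_borel_set x c r"
  shows "in_borel_set x c p"
  using assms
proof (induction c)
  case (Coordinate n)
  then show ?case by (auto intro: elem_dense)
next
  case (Complement c)
  show ?case
    unfolding in_borel_set.simps fneg_def
  proof (intro allI impI notI)
    fix q assume q: "(q, p) \<in> P" "in_borel_set x c q"
    from Complement.prems[OF q(1)] obtain r where r: "(r, q) \<in> P" "in_borel_set x (Complement c) r"
      by blast
    then show False
      using in_borel_set_mono[OF q(2) r(1)] le_refl[OF le_Field(1)[OF r(1)]] by (auto simp: fneg_def)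
  qed
next
  case (CountableUnion C)
  show ?case
    unfolding in_borel_set.simps fex_def
  proof (intro allI impI)
    fix q assume q: "(q, p) \<in> P"
    from CountableUnion.prems[OF q] obtain r where r: "(r, q) \<in> P" "in_borel_set x (CountableUnion C) r"
      by blast
    then obtain s k where "(s, r) \<in> P" "in_borel_set x (C k) s"
      using fexD[OF _ le_Field(1)[OF r(1)], of "\<lambda>k. in_borel_set x (C k)"] by auto
    then show "\<exists>s k. (s, q) \<in> P \<and> in_borel_set x (C k) s" using le_trans[OF _ r(1)] by blast
  qed
qed

text \<open>
  \<open>I\<close> is the ideal of null sets for random reals and of meager sets for Cohen reals. The
  interpretation of Borel codes at a real avoiding \<open>I\<close> respects the Boolean operations modulo \<open>I\<close>.
\<close>

definition avoids :: "(nat, 'p) name \<Rightarrow> (nat \<Rightarrow> bool) set set \<Rightarrow> 'p \<Rightarrow> bool" where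
  "avoids x I p \<longleftrightarrow> (\<forall>c q. borel_set c \<in> I \<longrightarrow> (q, p) \<in> P \<longrightarrow> \<not> in_borel_set x c q)"

lemma avoids_mono: "avoids x I p \<Longrightarrow> (q, p) \<in> P \<Longrightarrow> avoids x I q"
  unfolding avoids_def using le_trans by blast

text \<open>No condition below \<open>p\<close> forces the complement, so by the clause for negation
  the conditions forcing \<open>c\<close> are dense below \<open>p\<close>.\<close>

lemma avoids_in_borel_set_of_complement:
  assumes x: "avoids x I p" and c: "- borel_set c \<in> I"
  shows "in_borel_set x c p"
proof (rule in_borel_set_dense)
  fix q assume q: "(q, p) \<in> P"
  have "\<not> in_borel_set x (Complement c) q" using x c q unfolding avoids_def by (metis borel_set.simps(2))
  then show "\<exists>r. (r, q) \<in> P \<and> in_borel_set x c r" by (auto simp: fneg_def)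
qed

text \<open>For disjoint sets the union of the two complements is everything, so \<open>p\<close>
  forces that union; some extension then forces one of the complements, against \<open>c\<close> or
  \<open>d\<close>.\<close>

lemma avoids_in_borel_sets_intersect:
  assumes x: "avoids x I p" and I: "{} \<in> I" and p: "p \<in> Field P"
    and c: "in_borel_set x c p" and d: "in_borel_set x d p"
  shows "borel_set c \<inter> borel_set d \<noteq> {}"
proof
  assume disj: "borel_set c \<inter> borel_set d = {}"
  define e where "e = CountableUnion (\<lambda>k::nat. Complement (if k = 0 then c else d))"
  have "borel_set e = - (borel_set c \<inter> borel_set d)"
    unfolding e_def by (auto split: if_splits)
  with disj I have "in_borel_set x e p" by (intro avoids_in_borel_set_of_complement[OF x]) simp
  from fexD[OF this[unfolded e_def in_borel_set.simps] p]
  obtain r k where r: "(r, p) \<in> P" "\<not> in_borel_set x (if k = (0 :: nat) then c else d) r"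
    using le_refl[OF le_Field(1)] by (fastforce simp: fneg_def split: if_splits)
  then show False using in_borel_set_mono[OF c r(1)] in_borel_set_mono[OF d r(1)] by (auto split: if_splits)
qed

text \<open>The name \<open>f\<close> evaluates \<open>F\<close> at the real \<open>x\<close> by way
  of Borel codes. Totality and mixing hold since the exceptional sets lie in \<open>I\<close>;
  relations between values hold since any two forced codes share a ground-model point.\<close>

lemma avoids_mixing_name:
  fixes F :: "(nat \<Rightarrow> bool) \<Rightarrow> nat \<Rightarrow> nat"
  assumes x: "avoids x I p" and p: "p \<in> Field P" and I: "{} \<in> I"
    and F: "\<And>n i. {z. F z n = i} \<in> sets borel"
    and mixing: "\<And>X Y k. infinite X \<Longrightarrow> infinite Y \<Longrightarrow>
      {z. \<forall>n\<in>X. F z n \<in> Y \<longrightarrow> F z n < k} \<in> I"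
  obtains f where "is_function f p" "is_mixing f p"
    "(\<And>z. inj (F z)) \<Longrightarrow> is_injective f p"
proof -
  have "\<exists>c. borel_set c = {z. F z n = i}" for n i
    using F[of n i] unfolding range_borel_set[symmetric] by (metis rangeE)
  then obtain a where a: "\<And>n i. borel_set (a n i) = {z. F z n = i}" by metis
  obtain e where e: "borel_set e = {}" using range_borel_set by (metis rangeE sets.empty_sets)
  define f where "f = {(ni, q). q \<in> Field P \<and> in_borel_set x (a (fst ni) (snd ni)) q}"
  have elem_f: "elem (n, i) f q \<longleftrightarrow> in_borel_set x (a n i) q" if q: "q \<in> Field P" for n i q
  proof
    assume f: "elem (n, i) f q"
    show "in_borel_set x (a n i) q"
    proof (rule in_borel_set_dense)
      fix r assume "(r, q) \<in> P"
      with f obtain s t where st: "(s, r) \<in> P" "(s, t) \<in> P" "in_borel_set x (a n i) t"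
        unfolding f_def by (rule elem_nameD) simp
      then show "\<exists>s. (s, r) \<in> P \<and> in_borel_set x (a n i) s"
        using in_borel_set_mono[OF st(3,2)] by blast
    qed
  next
    assume "in_borel_set x (a n i) q"
    from in_borel_set_mono[OF this] show "elem (n, i) f q" unfolding f_def by (intro elem_nameI q) simp
  qed
  have meet: "{z. F z n = i} \<inter> {z. F z m = j} \<noteq> {}"
    if "(q, p) \<in> P" "elem (n, i) f q" "elem (m, j) f q" for n m i j q
    using avoids_in_borel_sets_intersect[OF avoids_mono[OF x that(1)] I, of "a n i" "a m j"]
      that elem_f[OF le_Field(1)[OF that(1)]] le_Field(1)[OF that(1)] by (simp add: a)
  have ex: "\<exists>r k. (r, q) \<in> P \<and> in_borel_set x (C k) r"
    if "- (\<Union>k. borel_set (C k)) \<in> I" "(q, p) \<in> P" for C :: "nat \<Rightarrow> borel_code" and q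
  proof -
    have "in_borel_set x (CountableUnion C) q"
      using that by (intro avoids_in_borel_set_of_complement[OF avoids_mono[OF x that(2)]]) simp
    from fexD[OF this[unfolded in_borel_set.simps] le_Field(1)[OF that(2)]] show ?thesis .
  qed
  show thesis
  proof (rule that)
    show "is_function f p"
      unfolding is_function_iff
    proof (intro conjI allI impI)
      fix n q assume q: "(q, p) \<in> P"
      have "- (\<Union>i. borel_set (a n i)) = {}" by (auto simp: a)
      with ex[of "a n" q] I q show "\<exists>r i. (r, q) \<in> P \<and> elem (n, i) f r"
        using elem_f le_Field(1) by metis
    next
      fix n i j q assume "(q, p) \<in> P" "elem (n, i) f q" "elem (n, j) f q"
      from meet[OF this] show "i = j" by blast
    qed
    show "is_injective f p" if inj: "\<And>z. inj (F z)"
      unfolding is_injective_iff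
    proof (intro allI impI)
      fix m n i q assume "(q, p) \<in> P" "elem (m, i) f q" "elem (n, i) f q"
      from meet[OF this] show "m = n" using inj by (auto dest: injD)
    qed
    show "is_mixing f p"
      unfolding is_mixing_iff
    proof (intro allI impI)
      fix X Y :: "nat set" and k q
      assume XY: "infinite X" "infinite Y" and q: "(q, p) \<in> P"
      \<comment> \<open>The admissible pairs are enumerated by one index to form a countable union;
        inadmissible ones get the code \<open>e\<close> of the empty set, which is never
        forced.\<close>
      define C where "C j = (case prod_decode j of (n, i) \<Rightarrow>
        if n \<in> X \<and> i \<in> Y \<and> k \<le> i then a n i else e)" for j
      have "(\<Union>j. borel_set (C j)) = (\<Union>(n, i). borel_set (C (prod_encode (n, i))))"
        by (auto simp: split_beta) (metis prod_decode_inverse prod.collapse)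
      also have "\<dots> = - {z. \<forall>n\<in>X. F z n \<in> Y \<longrightarrow> F z n < k}"
        by (auto simp: C_def a e split: if_splits) (metis not_less)
      finally have "- (\<Union>j. borel_set (C j)) \<in> I" using mixing[OF XY] by simp
      from ex[OF this q] obtain r j where r: "(r, q) \<in> P" "in_borel_set x (C j) r" by blast
      obtain n i where j: "prod_decode j = (n, i)" by fastforce
      have rp: "(r, p) \<in> P" using le_trans[OF r(1) q] .
      have "\<not> in_borel_set x e r" using x e I rp unfolding avoids_def by auto
      with r(2) j have ni: "n \<in> X" "i \<in> Y" "k \<le> i" "in_borel_set x (a n i) r"
        unfolding C_def by (auto split: if_splits)
      with r(1) elem_f[OF le_Field(1)[OF rp]]
      show "\<exists>r i n. (r, q) \<in> P \<and> k \<le> i \<and> i \<in> Y \<and> n \<in> X \<and> elem (n, i) f r" by blast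
    qed
  qed
qed

lemma is_random_avoids: "is_random x p \<Longrightarrow> p \<in> Field P \<Longrightarrow> avoids x (null_sets cantor_measure) p"
  using le_refl by (auto simp: is_random_def avoids_def fall_def fimp_def fneg_def ground_def)

lemma is_cohen_avoids: "is_cohen x p \<Longrightarrow> p \<in> Field P \<Longrightarrow> avoids x {A. meager A} p"
  using le_refl by (auto simp: is_cohen_def avoids_def fall_def fimp_def fneg_def ground_def)

end

section \<open>Random reals\<close>

text \<open>Column \<open>n\<close> consists of the coordinates \<open>prod_encode (n, j)\<close>. A
  column without zeros gets an unspecified value; the arguments below evaluate only columns that
  have one.\<close>

definition zero_index :: "(nat \<Rightarrow> bool) \<Rightarrow> nat \<Rightarrow> nat" where
  "zero_index z n = (LEAST j. \<not> z (prod_encode (n, j)))"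

lemma zero_index_eqI:
  assumes "\<And>j. j < i \<Longrightarrow> z (prod_encode (n, j))" "\<not> z (prod_encode (n, i))"
  shows "zero_index z n = i"
  unfolding zero_index_def
proof (rule Least_equality)
  show "i \<le> j" if "\<not> z (prod_encode (n, j))" for j using assms(1)[of j] that by (meson not_less)
qed fact

lemma borel_zero_index: "{z. zero_index z n = i} \<in> sets borel"
proof -
  have [measurable]: "(\<lambda>z :: nat \<Rightarrow> bool. z m) \<in> measurable borel (count_space UNIV)" for m :: nat
  proof -
    have "borel_set (Coordinate m) \<in> sets borel" using range_borel_set by blast
    then have "Measurable.pred borel (\<lambda>z :: nat \<Rightarrow> bool. z m)" unfolding Measurable.pred_def by simp
    then show ?thesis .
  qed
  have "(\<lambda>z. zero_index z n) \<in> measurable borel (count_space UNIV)"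
    unfolding zero_index_def by measurable
  then have "(\<lambda>z. zero_index z n) -` {i} \<inter> space borel \<in> sets borel" by (rule measurable_sets) simp
  then show ?thesis by (simp add: vimage_def)
qed

section \<open>Independence and cylinders for the coin-tossing measure\<close>

abbreviation fair_coin :: "bool measure" where
  "fair_coin \<equiv> measure_pmf (bernoulli_pmf (1 / 2))"

lemma prob_space_cantor: "prob_space cantor_measure"
  unfolding cantor_measure_def by (intro prob_space_PiM measure_pmf.prob_space_axioms)

text \<open>The joint law of the coordinates is \<open>cantor_measure\<close> itself, which is the
  product of their marginal laws.\<close>

lemma indep_vars_cantor:
  "prob_space.indep_vars cantor_measure (\<lambda>_. fair_coin) (\<lambda>m z. z m) UNIV"
proof -
  interpret prob_space cantor_measure by (rule prob_space_cantor)
  have meas: "(\<lambda>z. z m) \<in> measurable cantor_measure fair_coin" for m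
    unfolding cantor_measure_def by (rule measurable_component_singleton) simp
  have "distr cantor_measure fair_coin (\<lambda>z. z m) = fair_coin" for m
    unfolding cantor_measure_def
    by (rule distr_PiM_component) (simp_all add: measure_pmf.prob_space_axioms)
  moreover have "distr cantor_measure cantor_measure (\<lambda>x. x) = cantor_measure" by simp
  ultimately show ?thesis
    using meas by (subst indep_vars_iff_distr_eq_PiM') (simp_all add: cantor_measure_def restrict_def)
qed

lemma indep_vars_cantor_blocks:
  assumes "disjoint_family K"
  shows "prob_space.indep_vars cantor_measure (\<lambda>n. PiM (K n) (\<lambda>_. fair_coin)) (\<lambda>n z. restrict z (K n)) UNIV"
  using prob_space.indep_vars_restrict[OF prob_space_cantor indep_vars_cantor, of UNIV K] assms
  by simp

lemma measure_cantor_cylinder: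
  assumes "finite J"
  shows "measure cantor_measure {z. \<forall>m\<in>J. z m = s m} = (1 / 2) ^ card J"
proof -
  interpret product_prob_space "\<lambda>_. fair_coin" "UNIV :: nat set"
    by (intro product_prob_spaceI measure_pmf.prob_space_axioms)
  have "emeasure cantor_measure {z. \<forall>m\<in>J. z m = s m} = (\<Prod>m\<in>J. emeasure fair_coin {s m})"
    using emeasure_PiM_Collect[of J "\<lambda>m. {s m}"] assms
    by (simp add: cantor_measure_def space_PiM)
  also have "\<dots> = (\<Prod>m\<in>J. ennreal (1 / 2))"
  proof (rule prod.cong)
    show "emeasure fair_coin {s m} = ennreal (1 / 2)" for m
      by (cases "s m") (simp_all add: emeasure_pmf_single)
  qed simp
  also have "\<dots> = ennreal ((1 / 2) ^ card J)" unfolding prod_constant by (rule ennreal_power) simp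
  finally show ?thesis by (simp add: measure_def)
qed

text \<open>One value \<open>i\<close> of \<open>Y\<close> with \<open>k \<le> i\<close> suffices:
  the events that column \<open>n\<close> misses it are independent of equal probability below 1, so
  missing it on \<open>N\<close> columns has probability tending to 0.\<close>

lemma zero_index_hits_null:
  assumes X: "infinite X" and Y: "infinite Y"
  shows "{z. \<forall>n\<in>X. zero_index z n \<in> Y \<longrightarrow> zero_index z n < k} \<in> null_sets cantor_measure"
    (is "?A \<in> _")
proof -
  interpret prob_space cantor_measure by (rule prob_space_cantor)
  have space: "space cantor_measure = UNIV" by (simp add: cantor_measure_def space_PiM)
  obtain i where i: "k \<le> i" "i \<in> Y" using Y unfolding infinite_nat_iff_unbounded_le by blast
  define K where "K n = (\<lambda>j. prod_encode (n, j)) ` {..i}" for n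
  \<comment> \<open>On every block \<open>K n\<close> this is the pattern of \<open>i\<close> ones
    followed by a zero, which forces the first zero to be at \<open>i\<close>.\<close>
  define s where "s m = (m \<notin> range (\<lambda>n. prod_encode (n, i)))" for m
  define E where "E n = {z. \<not> (\<forall>m\<in>K n. z m = s m)}" for n
  have K: "disjoint_family K" "finite (K n)" "card (K n) = Suc i" for n
    by (auto simp: K_def disjoint_family_on_def card_image inj_on_def)
  \<comment> \<open>Independence of the blocks applies to preimages under restriction to a
    block.\<close>
  have E_eq: "E n = (\<lambda>z. restrict z (K n)) -` {w \<in> space (PiM (K n) (\<lambda>_. fair_coin)). \<exists>m\<in>K n. w m \<noteq> s m}
      \<inter> space cantor_measure" for n
    by (auto simp: E_def space space_PiM)
  have W: "{w \<in> space (PiM (K n) (\<lambda>_. fair_coin)). \<exists>m\<in>K n. w m \<noteq> s m} \<in> sets (PiM (K n) (\<lambda>_. fair_coin))" for n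
  proof -
    have "(\<lambda>w. w m \<noteq> s m) \<in> measurable (PiM (K n) (\<lambda>_. fair_coin)) (count_space UNIV)" if "m \<in> K n" for m
      using that by measurable
    then show ?thesis using K(2)[of n] by measurable
  qed
  have E_sets: "E n \<in> events" for n
    unfolding E_eq using indep_vars_cantor_blocks[OF K(1)] W
    by (intro measurable_sets[OF _ W]) (auto simp: indep_vars_def)
  have prob_E: "prob (E n) = 1 - (1 / 2) ^ Suc i" for n
  proof -
    have "E n = space cantor_measure - {z. \<forall>m\<in>K n. z m = s m}" by (auto simp: E_def space)
    moreover from this E_sets[of n] have "{z. \<forall>m\<in>K n. z m = s m} \<in> events"
      by (metis (no_types, lifting) double_diff order_refl sets.compl_sets space subset_UNIV)
    ultimately show ?thesis using prob_compl K measure_cantor_cylinder[of "K n" s] by simp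
  qed
  have A_sets: "?A \<in> events"
  proof -
    have "?A = (\<Inter>n\<in>X. \<Union>v\<in>{v. v \<in> Y \<longrightarrow> v < k}. {z. zero_index z n = v})" by auto
    also have "\<dots> \<in> sets borel"
      using X borel_zero_index by (intro sets.countable_INT'' sets.countable_UN') auto
    finally show ?thesis by (simp add: sets_cantor_measure)
  qed
  have "prob ?A \<le> (1 - (1 / 2) ^ Suc i) ^ N" for N
  proof (cases "N = 0")
    case False
    obtain J where J: "J \<subseteq> X" "finite J" "card J = N" using infinite_arbitrarily_large[OF X] by blast
    with False have "J \<noteq> {}" by auto
    have "?A \<subseteq> (\<Inter>n\<in>J. E n)"
    proof
      fix z assume z: "z \<in> ?A"
      have "z \<in> E n" if n: "n \<in> J" for n
      proof (rule ccontr)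
        assume "z \<notin> E n"
        then have "z (prod_encode (n, j)) = s (prod_encode (n, j))" if "j \<le> i" for j
          using that by (auto simp: E_def K_def)
        then have "zero_index z n = i" by (intro zero_index_eqI) (auto simp: s_def)
        with z i n J(1) show False by auto
      qed
      then show "z \<in> (\<Inter>n\<in>J. E n)" by blast
    qed
    then have "prob ?A \<le> prob (\<Inter>n\<in>J. E n)"
      using E_sets J \<open>J \<noteq> {}\<close> by (intro finite_measure_mono sets.finite_INT) auto
    also have "\<dots> = (\<Prod>n\<in>J. prob (E n))"
      unfolding E_eq
      using J \<open>J \<noteq> {}\<close> W by (intro indep_varsD[OF indep_vars_cantor_blocks[OF K(1)]]) auto
    also have "\<dots> = (1 - (1 / 2) ^ Suc i) ^ N" using J by (simp add: prob_E)
    finally show ?thesis .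
  qed simp
  moreover have "(\<lambda>N. (1 - (1 / 2) ^ Suc i) ^ N :: real) \<longlonglongrightarrow> 0"
  proof (rule LIMSEQ_power_zero)
    have "0 < (1 / 2 :: real) ^ Suc i" "(1 / 2 :: real) ^ Suc i \<le> 1"
      by (simp, rule power_le_one, simp_all)
    then show "norm (1 - (1 / 2) ^ Suc i :: real) < 1" unfolding real_norm_def by linarith
  qed
  ultimately have "prob ?A \<le> 0" by (intro LIMSEQ_le_const) auto
  then have "prob ?A = 0" using measure_nonneg[of cantor_measure ?A] by linarith
  with A_sets show ?thesis by (simp add: emeasure_eq_measure null_setsI)
qed

context forcing_notion
begin

lemma adds_random_imp_adds_mixing: "adds_random_reals \<Longrightarrow> adds_mixing_reals"
  unfolding adds_random_reals_def adds_mixing_reals_def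
proof (erule forced_fexI)
  fix p x assume p: "p \<in> Field P" and x: "is_random x p"
  obtain f where "is_function f p" "is_mixing f p"
    by (rule avoids_mixing_name[OF is_random_avoids[OF x p] p _ borel_zero_index zero_index_hits_null]) auto
  then show "\<exists>f. (is_function f \<^bold>\<and> is_mixing f) p" by (auto simp: fconj_def)
qed

end

section \<open>Cohen reals\<close>

definition fresh :: "nat set \<Rightarrow> nat \<Rightarrow> nat" where
  "fresh A v = (if v \<in> A then Suc (Max A) else v)"

primrec used_values :: "(nat \<Rightarrow> nat) \<Rightarrow> nat \<Rightarrow> nat set" where
  "used_values g 0 = {}"
| "used_values g (Suc n) = insert (fresh (used_values g n) (g n)) (used_values g n)"

definition injectivize :: "(nat \<Rightarrow> nat) \<Rightarrow> nat \<Rightarrow> nat" where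
  "injectivize g n = fresh (used_values g n) (g n)"

lemma finite_used_values: "finite (used_values g n)"
  by (induction n) simp_all

lemma used_values_eq: "used_values g n = injectivize g ` {..<n}"
  by (induction n) (simp_all add: injectivize_def lessThan_Suc)

lemma inj_injectivize: "inj (injectivize g)"
proof (rule linorder_inj_onI')
  fix m n :: nat assume "m < n"
  then have "injectivize g m \<in> used_values g n" by (simp add: used_values_eq)
  moreover have "fresh A v \<notin> A" if "finite A" for A v
    using Max_ge[OF that, of "Suc (Max A)"] by (auto simp: fresh_def)
  ultimately show "injectivize g m \<noteq> injectivize g n"
    unfolding injectivize_def[of g n] using finite_used_values by metis
qed

lemma used_values_local: "(\<And>m. m < n \<Longrightarrow> g m = h m) \<Longrightarrow> used_values g n = used_values h n"
  by (induction n) simp_all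

lemma injectivize_local: "(\<And>m. m \<le> n \<Longrightarrow> g m = h m) \<Longrightarrow> injectivize g n = injectivize h n"
  unfolding injectivize_def using used_values_local[of n g h] by simp

text \<open>The value at \<open>n\<close> depends on finitely many values of
  \<open>zero_index z\<close>, so the set splits over the countably many lists recording
  them.\<close>

lemma borel_injectivize_zero_index: "{z. injectivize (zero_index z) n = i} \<in> sets borel"
proof -
  have "{z. injectivize (zero_index z) n = i} =
    (\<Union>s\<in>{s :: nat list. injectivize ((!) s) n = i}. \<Inter>m\<in>{..n}. {z. zero_index z m = s ! m})"
    (is "?L = ?R")
  proof (intro equalityI subsetI)
    fix z assume z: "z \<in> ?L"
    define s where "s = map (zero_index z) [0..<Suc n]"
    have s: "zero_index z m = s ! m" if "m \<le> n" for m using that by (simp add: s_def del: upt_Suc)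
    with z injectivize_local[of n "zero_index z" "(!) s"] show "z \<in> ?R" by auto
  next
    fix z assume "z \<in> ?R"
    then obtain s where "injectivize ((!) s) n = i" "\<And>m. m \<le> n \<Longrightarrow> zero_index z m = s ! m" by auto
    with injectivize_local[of n "zero_index z" "(!) s"] show "z \<in> ?L" by simp
  qed
  also have "\<dots> \<in> sets borel"
    using borel_zero_index by (intro sets.countable_UN' sets.finite_INT) auto
  finally show ?thesis .
qed

section \<open>Cylinders and nowhere dense sets in the Cantor space\<close>

lemma open_contains_cylinder:
  fixes U :: "(nat \<Rightarrow> bool) set"
  assumes "open U" "z \<in> U"
  obtains N where "{w. \<forall>m<N. w m = z m} \<subseteq> U"
proof -
  obtain X where X: "z \<in> Pi\<^sub>E UNIV X" "finite {m. X m \<noteq> UNIV}" "Pi\<^sub>E UNIV X \<subseteq> U"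
    using product_topology_open_contains_basis[OF assms(1)[unfolded open_fun_def] assms(2)] by auto
  obtain N where N: "\<And>m. X m \<noteq> UNIV \<Longrightarrow> m < N"
    using X(2) unfolding finite_nat_set_iff_bounded by blast
  have "{w. \<forall>m<N. w m = z m} \<subseteq> Pi\<^sub>E UNIV X"
  proof (intro subsetI PiE_I)
    fix w m assume "w \<in> {w. \<forall>m<N. w m = z m}"
    then show "w m \<in> X m" using N[of m] X(1) by (cases "X m = UNIV") (auto simp: PiE_iff)
  qed simp
  also note X(3)
  finally show thesis by (rule that)
qed

lemma open_cylinder: "open {w :: nat \<Rightarrow> bool. \<forall>m<N. w m = z m}"
proof -
  have "open {w :: nat \<Rightarrow> bool. \<forall>m\<in>{..<N}. w m \<in> {z m}}"
    by (rule product_topology_basis') (simp_all add: Topological_Spaces.open_discrete)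
  then show ?thesis by (simp add: Ball_def)
qed

lemma interior_closure_emptyI:
  assumes "\<And>U. open U \<Longrightarrow> U \<noteq> {} \<Longrightarrow> \<exists>V. open V \<and> V \<noteq> {} \<and> V \<subseteq> U \<and> V \<inter> A = {}"
  shows "interior (closure A) = {}"
proof (rule ccontr)
  assume "interior (closure A) \<noteq> {}"
  from assms[OF open_interior this] obtain V where
    V: "open V" "V \<noteq> {}" "V \<subseteq> interior (closure A)" "V \<inter> A = {}" by blast
  then have "V \<inter> closure A = {}" by (simp add: open_Int_closure_eq_empty)
  with V(2,3) interior_subset show False by blast
qed

lemma injectivize_zero_index_misses_meager:
  assumes X: "infinite X" and Y: "infinite Y"
  shows "meager {z. \<forall>n\<in>X. injectivize (zero_index z) n \<in> Y \<longrightarrow> injectivize (zero_index z) n < k}"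
    (is "meager ?A")
proof -
  have "interior (closure ?A) = {}"
  proof (rule interior_closure_emptyI)
    fix U :: "(nat \<Rightarrow> bool) set" assume U: "open U" "U \<noteq> {}"
    then obtain z where "z \<in> U" by blast
    from open_contains_cylinder[OF U(1) this] obtain N where N: "{w. \<forall>m<N. w m = z m} \<subseteq> U" .
    \<comment> \<open>Zeros beyond \<open>N\<close> give every column a first zero, so the values
      used before \<open>n\<close> are determined.\<close>
    define z0 where "z0 m = (m < N \<and> z m)" for m
    \<comment> \<open>As \<open>n \<le> prod_encode (n, j)\<close>, the cylinder does not restrict
      column \<open>n\<close>.\<close>
    obtain n where n: "n \<in> X" "N \<le> n" using X unfolding infinite_nat_iff_unbounded_le by blast
    have "infinite (Y - used_values (zero_index z0) n)" using Y by (simp add: finite_used_values)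
    then obtain i where i: "i \<in> Y" "i \<notin> used_values (zero_index z0) n" "k \<le> i"
      unfolding infinite_nat_iff_unbounded_le by blast
    define z1 where "z1 m = (z0 m \<or> (\<exists>j<i. m = prod_encode (n, j)))" for m
    have z0_False: "\<not> z0 (prod_encode (m, j))" if "N \<le> m \<or> N \<le> j" for m j
      using that le_prod_encode_1[of m j] le_prod_encode_2[of j m] unfolding z0_def by linarith
    have z1_n: "zero_index z1 n = i"
      using z0_False n(2) by (intro zero_index_eqI) (auto simp: z1_def)
    have z1_less: "zero_index z1 m = zero_index z0 m" if "m < n" for m
      unfolding zero_index_def using that by (simp add: z1_def)
    \<comment> \<open>Every column of \<open>z1\<close> has a zero at position \<open>N + i\<close>,
      so agreement up to there in columns \<open>0\<close> to \<open>n\<close> fixes their first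
      zeros.\<close>
    define M where "M = Suc (Max (prod_encode ` ({..n} \<times> {..N + i})))"
    have M: "prod_encode (m, j) < M" if "m \<le> n" "j \<le> N + i" for m j
      using that unfolding M_def by (intro le_imp_less_Suc Max_ge imageI) auto
    define V where "V = {w. \<forall>m<max M N. w m = z1 m}"
    have "V \<subseteq> {w. \<forall>m<N. w m = z m}"
    proof
      fix w assume w: "w \<in> V"
      have "z1 m = z m" if "m < N" for m
      proof -
        have "m \<noteq> prod_encode (n, j)" for j using that n(2) le_prod_encode_1[of n j] by linarith
        with that show ?thesis by (simp add: z1_def z0_def)
      qed
      with w show "w \<in> {w. \<forall>m<N. w m = z m}" by (simp add: V_def)
    qed
    with N have "V \<subseteq> U" by (rule subset_trans[rotated])
    have avoid: "w \<notin> ?A" if w: "w \<in> V" for w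
    proof -
      have eq: "zero_index w m = zero_index z1 m" if m: "m \<le> n" for m
      proof (rule zero_index_eqI)
        have F: "\<not> z1 (prod_encode (m, N + i))"
          using z0_False[of m "N + i"] by (auto simp: z1_def)
        have le: "zero_index z1 m \<le> N + i" unfolding zero_index_def using F by (rule Least_le)
        have w_eq: "w (prod_encode (m, j)) = z1 (prod_encode (m, j))" if "j \<le> N + i" for j
          using w M[OF m that] by (simp add: V_def)
        show "\<not> w (prod_encode (m, zero_index z1 m))"
          using w_eq[OF le] LeastI[of "\<lambda>j. \<not> z1 (prod_encode (m, j))" "N + i"] F
          unfolding zero_index_def by simp
        show "w (prod_encode (m, j))" if "j < zero_index z1 m" for j
          using w_eq[of j] le that not_less_Least[of j "\<lambda>j. \<not> z1 (prod_encode (m, j))"]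
          unfolding zero_index_def by simp
      qed
      have "used_values (zero_index w) n = used_values (zero_index z0) n"
        using eq z1_less by (intro used_values_local) simp
      then have "injectivize (zero_index w) n = i"
        using eq[of n] z1_n i(2) by (simp add: injectivize_def fresh_def)
      with n(1) i show ?thesis by auto
    qed
    show "\<exists>V. open V \<and> V \<noteq> {} \<and> V \<subseteq> U \<and> V \<inter> ?A = {}"
    proof (intro exI conjI)
      show "open V" unfolding V_def by (rule open_cylinder)
      have "z1 \<in> V" by (simp add: V_def)
      then show "V \<noteq> {}" by blast
      show "V \<subseteq> U" by fact
      show "V \<inter> ?A = {}" using avoid by (intro equals0I) (elim IntE, rule notE)
    qed
  qed
  then show ?thesis unfolding meager_def by (intro exI[of _ "\<lambda>_. ?A"]) auto
qed

lemma meager_empty: "meager {}"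
  unfolding meager_def by (intro exI[of _ "\<lambda>_. {}"]) simp

context forcing_notion
begin

lemma adds_cohen_imp_adds_mixing_injections: "adds_cohen_reals \<Longrightarrow> adds_mixing_injections"
  unfolding adds_cohen_reals_def adds_mixing_injections_def
proof (erule forced_fexI)
  fix p x assume p: "p \<in> Field P" and x: "is_cohen x p"
  obtain f where "is_function f p" "is_mixing f p" "is_injective f p"
  proof (rule avoids_mixing_name[OF is_cohen_avoids[OF x p] p _ borel_injectivize_zero_index])
    show "{} \<in> {A. meager A}" using meager_empty by simp
    show "{z. \<forall>n\<in>X. injectivize (zero_index z) n \<in> Y \<longrightarrow> injectivize (zero_index z) n < k} \<in> {A. meager A}"
      if "infinite X" "infinite Y" for X Y k
      using injectivize_zero_index_misses_meager[OF that] by simp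
  qed (use inj_injectivize in blast)
  then show "\<exists>f. (is_function f \<^bold>\<and> is_injective f \<^bold>\<and> is_mixing f) p" by (auto simp: fconj_def)
qed

end

theorem proposition1p14:
  fixes P :: "'p rel"
  assumes "forcing_notion P"
  shows "(forcing_notion.adds_random_reals P \<longrightarrow> forcing_notion.adds_mixing_reals P) \<and>
         (forcing_notion.adds_dominating_reals P \<longrightarrow> forcing_notion.adds_mixing_reals P) \<and>
         (forcing_notion.adds_cohen_reals P \<longrightarrow> forcing_notion.adds_mixing_injections P) \<and>
         (forcing_notion.adds_mixing_injections P \<longrightarrow> forcing_notion.adds_unbounded_reals P) \<and>
         (forcing_notion.laver_property P \<longrightarrow> forcing_notion.adds_no_mixing_injections P)"
proof -
  interpret forcing_notion P by fact
  show ?thesis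
    using adds_random_imp_adds_mixing adds_dominating_imp_adds_mixing
      adds_cohen_imp_adds_mixing_injections adds_mixing_injections_imp_adds_unbounded
      laver_imp_adds_no_mixing_injections
    by (intro conjI impI)
qed

end
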